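(* Let $\phi$ (with potential $\Phi$), $F$ and $j$ satisfy the standing assumptions stated in the context. For $\delta>0$ set $D_\delta(\Psi+J):=\{v\in D(\Psi+J):|\overline{v}|\le\delta\}$, where $\overline{v}:=\frac1T\int_0^Tv(t)\,dt$. Assume that there is some $\delta>0$ such that $$\inf_{D_\delta(\Psi+J)}\mathcal{E}=\inf_{D(\Psi+J)}\mathcal{E}.$$ Then $\mathcal{E}$ is bounded from below on $C$ and attains its infimum at some $u\in D_\delta(\Psi+J)$, which is a solution of the boundary value problem $$-[\phi(u')]'=\nabla_uF(t,u)\ \text{ in }[0,T],\qquad \big(\phi(u')(0),-\phi(u')(T)\big)\in\partial j(u(0),u(T)).$$
   Context: $N\ge 1$ is an integer, $T>0$, $0<a<\infty$; $|\cdot|$ is the Euclidean norm on $\mathbb{R}^N$; $B_a$ is the open ball of radius $a$ centered at $0$. Standing assumptions. (1) $\phi$ is a homeomorphism from $B_a$ onto $\mathbb{R}^N$ with $\phi(0)=0$ and $\phi=\nabla\Phi$ on $B_a$, where $\Phi:\overline{B}_a\to(-\infty,0]$ is of class $C^1$ on $B_a$, and continuous and strictly convex on $\overline{B}_a$. (2) $F=F(t,u):[0,T]\times\mathbb{R}^N\to\mathbb{R}$ is continuous, $\nabla_uF$ exists and is continuous on $[0,T]\times\mathbb{R}^N$, and $F(\cdot,0)=0$. (3) $j:\mathbb{R}^N\times\mathbb{R}^N\to(-\infty,+\infty]$ is proper, convex, lower semicontinuous, $j(0)=0$ and $0\in\partial j(0)$, where $\partial j$ is the subdifferential of convex analysis.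 A solution of the boundary value problem is a function $u\in C^1([0,T];\mathbb{R}^N)$ with $|u'(t)|<a$ for all $t\in[0,T]$, $\phi(u')\in C^1([0,T];\mathbb{R}^N)$, $(u(0),u(T))\in D(\partial j)=\{z:\partial j(z)\ne\emptyset\}$, satisfying the system and the boundary condition; $\phi(u')(t)=\phi(u'(t))$. $C:=C([0,T];\mathbb{R}^N)$ with the uniform norm; $W^{1,\infty}:=W^{1,\infty}([0,T];\mathbb{R}^N)$; $\mathcal{K}:=\{v\in W^{1,\infty}:\|v'\|_{L^\infty}\le a\}$. $\Psi:C\to(-\infty,+\infty]$ is $\Psi(v)=\int_0^T[\Phi(v')-\Phi(0)]\,dt$ if $v\in\mathcal{K}$ and $\Psi(v)=+\infty$ otherwise; $J(v)=j(v(0),v(T))$; $\mathcal{F}(v)=-\int_0^TF(t,v(t))\,dt$ for $v\in C$. The energy functional is $\mathcal{E}:=\Psi+J+\mathcal{F}:C\to(-\infty,+\infty]$. $D(\Psi+J)=\{v\in\mathcal{K}:j(v(0),v(T))<+\infty\}$. *)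

theory Defs
  imports "HOL-Analysis.Analysis" "HOL-Probability.Essential_Supremum"
begin

text \<open>
  A function on $[0,T]$ is represented by a total function on the reals; every notion below depends
  only on its values on \<open>{0..T}\<close>. Integrals are Lebesgue integrals with respect to the completed
  measure \<open>lebesgue_on {0..T}\<close>.
\<close>

definition strictly_convex_on :: "'a::real_vector set \<Rightarrow> ('a \<Rightarrow> real) \<Rightarrow> bool" where
  "strictly_convex_on S f \<longleftrightarrow> convex S \<and>
    (\<forall>x\<in>S. \<forall>y\<in>S. \<forall>s. x \<noteq> y \<longrightarrow> 0 < s \<longrightarrow> s < 1 \<longrightarrow>
       f ((1 - s) *\<^sub>R x + s *\<^sub>R y) < (1 - s) * f x + s * f y)"

definition proper_fun :: "('a \<Rightarrow> ereal) \<Rightarrow> bool" where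
  "proper_fun f \<longleftrightarrow> (\<forall>x. f x \<noteq> -\<infinity>) \<and> (\<exists>x. f x \<noteq> \<infinity>)"

definition convex_fun :: "('a::real_vector \<Rightarrow> ereal) \<Rightarrow> bool" where
  "convex_fun f \<longleftrightarrow>
    (\<forall>x y s. 0 < s \<longrightarrow> s < 1 \<longrightarrow>
       f ((1 - s) *\<^sub>R x + s *\<^sub>R y) \<le> ereal (1 - s) * f x + ereal s * f y)"

definition lower_semicontinuous :: "('a::topological_space \<Rightarrow> ereal) \<Rightarrow> bool" where
  "lower_semicontinuous f \<longleftrightarrow> (\<forall>x. f x \<le> Liminf (at x) f)"

text \<open>For a proper \<open>f\<close> the subdifferential is empty at every point where \<open>f\<close> is infinite.\<close>

definition subdifferential :: "('a::real_inner \<Rightarrow> ereal) \<Rightarrow> 'a \<Rightarrow> 'a set" where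
  "subdifferential f z = {\<zeta>. \<forall>\<xi>. f z + ereal (\<zeta> \<bullet> (\<xi> - z)) \<le> f \<xi>}"

definition C_space :: "real \<Rightarrow> (real \<Rightarrow> 'a::topological_space) set" where
  "C_space T = {v. continuous_on {0..T} v}"

text \<open>\<open>v\<close> is of class $C^1$ on the closed interval, with derivative \<open>dv\<close> (one-sided at the end points).\<close>

definition C1_with_deriv ::
  "real \<Rightarrow> (real \<Rightarrow> 'a::real_normed_vector) \<Rightarrow> (real \<Rightarrow> 'a) \<Rightarrow> bool" where
  "C1_with_deriv T v dv \<longleftrightarrow> continuous_on {0..T} dv \<and>
     (\<forall>t\<in>{0..T}. (v has_vector_derivative dv t) (at t within {0..T}))"

definition Linf_norm :: "real \<Rightarrow> (real \<Rightarrow> 'a::real_normed_vector) \<Rightarrow> ereal" where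
  "Linf_norm T g = esssup (lebesgue_on {0..T}) (\<lambda>t. ereal (norm (g t)))"

definition Linf_space :: "real \<Rightarrow> (real \<Rightarrow> 'a::real_normed_vector) set" where
  "Linf_space T = {g \<in> borel_measurable (lebesgue_on {0..T}). Linf_norm T g < \<infinity>}"

text \<open>Test functions of class $C^1$ with compact support in the open interval.\<close>

definition test_functions :: "real \<Rightarrow> (real \<Rightarrow> real) set" where
  "test_functions T = {\<eta>. \<eta> C1_differentiable_on UNIV \<and> closure {t. \<eta> t \<noteq> 0} \<subseteq> {0<..<T}}"

definition is_weak_deriv ::
  "real \<Rightarrow> (real \<Rightarrow> 'a::euclidean_space) \<Rightarrow> (real \<Rightarrow> 'a) \<Rightarrow> bool" where
  "is_weak_deriv T v g \<longleftrightarrow>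
    (\<forall>\<eta>\<in>test_functions T.
       (LINT t|lebesgue_on {0..T}. deriv \<eta> t *\<^sub>R v t) = - (LINT t|lebesgue_on {0..T}. \<eta> t *\<^sub>R g t))"

definition W1inf_space :: "real \<Rightarrow> (real \<Rightarrow> 'a::euclidean_space) set" where
  "W1inf_space T = {v \<in> Linf_space T. \<exists>g\<in>Linf_space T. is_weak_deriv T v g}"

text \<open>
  The weak derivative is determined up to null sets; we select a representative. The quantities in
  which it is used below do not depend on the selection.
\<close>

definition weak_deriv :: "real \<Rightarrow> (real \<Rightarrow> 'a::euclidean_space) \<Rightarrow> real \<Rightarrow> 'a" where
  "weak_deriv T v = (SOME g. g \<in> Linf_space T \<and> is_weak_deriv T v g)"

definition mean_value :: "real \<Rightarrow> (real \<Rightarrow> 'a::euclidean_space) \<Rightarrow> 'a" where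
  "mean_value T v = (1 / T) *\<^sub>R (LINT t|lebesgue_on {0..T}. v t)"

text \<open>
  Elements of $W^{1,\infty}$ are identified with their continuous representatives, so that
  \<open>K_set\<close> is a subset of \<open>C_space T\<close>.
\<close>

definition K_set :: "real \<Rightarrow> real \<Rightarrow> (real \<Rightarrow> 'a::euclidean_space) set" where
  "K_set T a = {v \<in> C_space T \<inter> W1inf_space T. Linf_norm T (weak_deriv T v) \<le> ereal a}"

definition Psi_fun ::
  "real \<Rightarrow> real \<Rightarrow> ('a::euclidean_space \<Rightarrow> real) \<Rightarrow> (real \<Rightarrow> 'a) \<Rightarrow> ereal" where
  "Psi_fun T a \<Phi> v =
    (if v \<in> K_set T a
     then ereal (LINT t|lebesgue_on {0..T}. (\<Phi> (weak_deriv T v t) - \<Phi> 0))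
     else \<infinity>)"

definition J_fun :: "real \<Rightarrow> ('a \<times> 'a \<Rightarrow> ereal) \<Rightarrow> (real \<Rightarrow> 'a) \<Rightarrow> ereal" where
  "J_fun T j v = j (v 0, v T)"

definition F_fun :: "real \<Rightarrow> (real \<Rightarrow> 'a \<Rightarrow> real) \<Rightarrow> (real \<Rightarrow> 'a) \<Rightarrow> real" where
  "F_fun T F v = - (LINT t|lebesgue_on {0..T}. F t (v t))"

definition energy ::
  "real \<Rightarrow> real \<Rightarrow> ('a::euclidean_space \<Rightarrow> real) \<Rightarrow> (real \<Rightarrow> 'a \<Rightarrow> real) \<Rightarrow> ('a \<times> 'a \<Rightarrow> ereal)
     \<Rightarrow> (real \<Rightarrow> 'a) \<Rightarrow> ereal" where
  "energy T a \<Phi> F j v = Psi_fun T a \<Phi> v + J_fun T j v + ereal (F_fun T F v)"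

definition dom_PsiJ ::
  "real \<Rightarrow> real \<Rightarrow> ('a::euclidean_space \<times> 'a \<Rightarrow> ereal) \<Rightarrow> (real \<Rightarrow> 'a) set" where
  "dom_PsiJ T a j = {v \<in> K_set T a. j (v 0, v T) < \<infinity>}"

definition dom_PsiJ_mean ::
  "real \<Rightarrow> real \<Rightarrow> ('a::euclidean_space \<times> 'a \<Rightarrow> ereal) \<Rightarrow> real \<Rightarrow> (real \<Rightarrow> 'a) set" where
  "dom_PsiJ_mean T a j \<delta> = {v \<in> dom_PsiJ T a j. norm (mean_value T v) \<le> \<delta>}"

text \<open>\<open>gradF t u\<close> is the gradient of \<open>F t\<close> at \<open>u\<close>.\<close>

definition is_solution ::
  "real \<Rightarrow> real \<Rightarrow> ('a::euclidean_space \<Rightarrow> 'a) \<Rightarrow> (real \<Rightarrow> 'a \<Rightarrow> 'a) \<Rightarrow> ('a \<times> 'a \<Rightarrow> ereal)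
     \<Rightarrow> (real \<Rightarrow> 'a) \<Rightarrow> bool" where
  "is_solution T a \<phi> gradF j u \<longleftrightarrow>
    (\<exists>du dw.
       C1_with_deriv T u du \<and>
       (\<forall>t\<in>{0..T}. norm (du t) < a) \<and>
       C1_with_deriv T (\<lambda>t. \<phi> (du t)) dw \<and>
       subdifferential j (u 0, u T) \<noteq> {} \<and>
       (\<forall>t\<in>{0..T}. - dw t = gradF t (u t)) \<and>
       (\<phi> (du 0), - \<phi> (du T)) \<in> subdifferential j (u 0, u T))"

end

theory Submission
  imports Defs "HOL-Complex_Analysis.Great_Picard"
begin

text \<open>
  A minimising sequence in \<open>D\<^sub>\<delta>\<close> is equi-Lipschitz and bounded, so it converges uniformly along a
  subsequence, and \<open>\<Psi> + J\<close> is lower semicontinuous under uniform convergence. A minimiser \<open>u\<close> also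
  minimises the convex functional obtained by linearising \<open>F\<close> at \<open>u\<close>. With
  \<open>P t = \<integral>\<^sub>0\<^sup>t \<nabla>F(s, u s) ds\<close>, the Euler equation of that functional reads
  \<open>\<phi>(u') = c - P\<close>. Rather than deriving it from variations, which would require \<open>norm u' < a\<close> beforehand,
  one finds \<open>c\<close> such that \<open>\<phi>\<^sup>-\<^sup>1(c - P)\<close> has the same mean as \<open>u'\<close>, by minimising a dual functional on the
  finite-dimensional space, and concludes \<open>u' = \<phi>\<^sup>-\<^sup>1(c - P)\<close> from strict convexity. The boundary condition
  follows from affine variations, admissible because \<open>u'\<close> now stays away from the sphere of radius \<open>a\<close>.
\<close>

section \<open>Integration on an interval\<close>

text \<open>Before anything is known about the slope of \<open>u\<close>, the only safe variations
  are segments from \<open>u\<close> to other points of the convex set \<open>K_set\<close>. Along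
  them the convex part of the energy lies below its chord and only the \<open>F\<close> part is
  differentiated; hence minimality passes to the linearised functional. Equal means serve two
  purposes: the competitor with slope \<open>\<psi> (c - P t)\<close> then has the end values of
  \<open>u\<close>, so \<open>j\<close>, which need not be differentiable, drops out; and the
  constant \<open>c\<close> is orthogonal to the difference of the two slopes. The dual functional
  is coercive only if the mean slope has norm strictly below \<open>a\<close>, whereas the
  constraint gives the weak inequality. The gap is closed by surjectivity of \<open>\<phi>\<close>:
  a bounded ball is mapped onto the whole space, so the radial slope of \<open>\<Phi>\<close> is
  unbounded at the sphere although \<open>\<Phi>\<close> is finite there. The hypothesis on the
  infima does two jobs: bounded means give compactness, and a minimiser found under that bound is a
  minimiser without it.\<close>

lemma integrable_bounded_interval:
  fixes g :: "real \<Rightarrow> 'a::euclidean_space"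
  assumes "g \<in> borel_measurable (lebesgue_on {0..T})" "\<And>t. t \<in> {0..T} \<Longrightarrow> norm (g t) \<le> B"
  shows "integrable (lebesgue_on {0..T}) g"
proof -
  interpret finite_measure "lebesgue_on {0..T}"
    by (rule finite_measure_lebesgue_on) simp
  show ?thesis
    by (rule integrable_const_bound[of _ B]) (use assms in auto)
qed

lemma LINT_interval_eq_integral:
  fixes g :: "real \<Rightarrow> 'a::euclidean_space"
  assumes "integrable (lebesgue_on {0..T}) g"
  shows "(LINT t|lebesgue_on {0..T}. g t) = integral {0..T} g"
  by (metis assms has_integral_integral_lebesgue_on integral_unique lmeasurable_cbox cbox_interval
      fmeasurableD)

text \<open>Makes Fubini applicable on the triangle \<open>s \<le> t\<close>. The factors carry
  Lebesgue rather than Borel sets, so measurability is drawn from the two coordinate maps.\<close>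

lemma measurable_indicator_atMost:
  "(\<lambda>(s,t). indicator {..t::real} s :: real) \<in> borel_measurable (lebesgue_on A \<Otimes>\<^sub>M lebesgue_on A)"
proof -
  have id: "(\<lambda>x. x) \<in> borel_measurable (lebesgue_on A)"
    using id_borel_measurable_lebesgue_on[of A] by (simp add: id_def)
  have [measurable]: "fst \<in> borel_measurable (lebesgue_on A \<Otimes>\<^sub>M lebesgue_on A)"
    "snd \<in> borel_measurable (lebesgue_on A \<Otimes>\<^sub>M lebesgue_on A)"
    using measurable_comp[OF measurable_fst id] measurable_comp[OF measurable_snd id]
    by (simp_all add: comp_def)
  have "(\<lambda>p. if fst p \<le> snd p then 1 else 0 :: real)
      \<in> borel_measurable (lebesgue_on A \<Otimes>\<^sub>M lebesgue_on A)"
    by measurable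
  then show ?thesis
    by (rule measurable_cong[THEN iffD1, rotated]) (auto simp: indicator_def)
qed

lemma integrable_indicator_lebesgue_on:
  fixes f :: "real \<Rightarrow> 'a::euclidean_space"
  assumes f: "integrable (lebesgue_on S) f" and A: "A \<in> sets borel"
  shows "integrable (lebesgue_on S) (\<lambda>s. indicator A s *\<^sub>R f s)"
proof (rule Bochner_Integration.integrable_bound[OF f])
  have "(\<lambda>s. indicator A s :: real) \<in> borel_measurable (lebesgue_on S)"
    using A by (intro measurable_restrict_space1 borel_measurable_indicator) simp
  then show "(\<lambda>s. indicator A s *\<^sub>R f s) \<in> borel_measurable (lebesgue_on S)"
    using f by (intro borel_measurable_scaleR) auto
qed (auto simp: indicator_def)

lemma integral_upto_eq_LINT:
  fixes g :: "real \<Rightarrow> 'a::euclidean_space"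
  assumes g: "integrable (lebesgue_on {0..T}) g" and t: "t \<in> {0..T}"
  shows "(LINT s|lebesgue_on {0..T}. indicator {..t} s *\<^sub>R g s) = integral {0..t} g"
proof -
  have "integrable (lebesgue_on {0..T}) (\<lambda>s. indicator {..t} s *\<^sub>R g s)"
    using g by (rule integrable_indicator_lebesgue_on) simp
  then have "(LINT s|lebesgue_on {0..T}. indicator {..t} s *\<^sub>R g s)
      = integral {0..T} (\<lambda>s. indicator {..t} s *\<^sub>R g s)"
    by (rule LINT_interval_eq_integral)
  also have "\<dots> = integral {0..T} (\<lambda>s. if s \<in> {0..t} then g s else 0)"
    by (rule integral_cong) (auto simp: indicator_def)
  also have "\<dots> = integral {0..t} g"
    unfolding integral_restrict_Int using t by (simp add: Int_absorb2 atLeastatMost_subset_iff)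
  finally show ?thesis .
qed

lemma integral_from_eq_LINT:
  fixes g :: "real \<Rightarrow> 'a::euclidean_space"
  assumes g: "integrable (lebesgue_on {0..T}) g" and t: "t \<in> {0..T}"
  shows "(LINT s|lebesgue_on {0..T}. indicator {..s} t *\<^sub>R g s) = integral {t..T} g"
proof -
  have eq: "indicator {..s} t = (indicator {t..} s :: real)" for s
    by (auto simp: indicator_def)
  have "integrable (lebesgue_on {0..T}) (\<lambda>s. indicator {t..} s *\<^sub>R g s)"
    using g by (rule integrable_indicator_lebesgue_on) simp
  then have "(LINT s|lebesgue_on {0..T}. indicator {t..} s *\<^sub>R g s)
      = integral {0..T} (\<lambda>s. indicator {t..} s *\<^sub>R g s)"
    by (rule LINT_interval_eq_integral)
  also have "\<dots> = integral {0..T} (\<lambda>s. if s \<in> {t..T} then g s else 0)"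
    by (rule integral_cong) (auto simp: indicator_def)
  also have "\<dots> = integral {t..T} g"
    unfolding integral_restrict_Int using t by (simp add: Int_absorb2 atLeastatMost_subset_iff)
  finally show ?thesis by (simp add: eq)
qed

text \<open>Fubini on the triangle \<open>s \<le> t\<close>: both sides integrate
  \<open>p t \<bullet>\<bullet> g s\<close> over it, with bounded measurable data only. The product
  is left abstract because scalar multiplication (test functions) and the inner product
  (\<open>f\<close> against a slope) both occur.\<close>

lemma integral_by_parts_bilinear:
  fixes p :: "real \<Rightarrow> 'a::euclidean_space" and g :: "real \<Rightarrow> 'b::euclidean_space"
    and prod :: "'a \<Rightarrow> 'b \<Rightarrow> 'c::euclidean_space" (infixl "\<bullet>\<bullet>" 70)
  assumes bil: "bounded_bilinear (\<bullet>\<bullet>)"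
    and p: "p \<in> borel_measurable (lebesgue_on {0..T})" "\<And>t. t \<in> {0..T} \<Longrightarrow> norm (p t) \<le> A"
    and g: "g \<in> borel_measurable (lebesgue_on {0..T})" "\<And>t. t \<in> {0..T} \<Longrightarrow> norm (g t) \<le> B"
  shows "(LINT t|lebesgue_on {0..T}. p t \<bullet>\<bullet> integral {0..t} g)
       = (LINT s|lebesgue_on {0..T}. integral {s..T} p \<bullet>\<bullet> g s)"
proof -
  interpret bounded_bilinear "(\<bullet>\<bullet>)" by (rule bil)
  define M where "M = lebesgue_on {0..T}"
  have fin: "finite_measure M"
    unfolding M_def by (rule finite_measure_lebesgue_on) simp
  interpret M: finite_measure M by (rule fin)
  interpret MM: pair_sigma_finite M M ..
  interpret P: finite_measure "M \<Otimes>\<^sub>M M"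
    by (rule finite_measure_pair_measure) (rule fin)+
  have sp: "space M = {0..T}" by (simp add: M_def)
  have pM[measurable]: "p \<in> borel_measurable M" and gM[measurable]: "g \<in> borel_measurable M"
    using p g by (auto simp: M_def)
  have pI: "integrable (lebesgue_on {0..T}) p" and gI: "integrable (lebesgue_on {0..T}) g"
    using p g by (blast intro: integrable_bounded_interval)+
  have ind: "(\<lambda>(s,t). indicator {..t} s :: real) \<in> borel_measurable (M \<Otimes>\<^sub>M M)"
    unfolding M_def by (rule measurable_indicator_atMost)
  obtain K where K: "K > 0" "\<And>x y. norm (x \<bullet>\<bullet> y) \<le> norm x * norm y * K"
    using pos_bounded by blast
  have cont: "continuous_on UNIV (\<lambda>x. fst x \<bullet>\<bullet> snd x)"
    by (intro continuous_on continuous_intros)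
  have "(\<lambda>z. (p (snd z), g (fst z))) \<in> borel_measurable (M \<Otimes>\<^sub>M M)"
    by (intro borel_measurable_Pair) measurable
  from borel_measurable_continuous_on[OF cont this]
  have meas: "(\<lambda>(s,t). indicator {..t} s *\<^sub>R (p t \<bullet>\<bullet> g s)) \<in> borel_measurable (M \<Otimes>\<^sub>M M)"
    using ind by (auto simp: case_prod_beta intro!: borel_measurable_scaleR)
  have int: "integrable (M \<Otimes>\<^sub>M M) (\<lambda>(s,t). indicator {..t} s *\<^sub>R (p t \<bullet>\<bullet> g s))"
  proof (rule P.integrable_const_bound[of _ "A * B * K"])
    show "AE x in M \<Otimes>\<^sub>M M. norm (case x of (s,t) \<Rightarrow> indicator {..t} s *\<^sub>R (p t \<bullet>\<bullet> g s)) \<le> A * B * K"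
    proof (rule AE_I2, clarify)
      fix s t assume "(s,t) \<in> space (M \<Otimes>\<^sub>M M)"
      then have st: "s \<in> {0..T}" "t \<in> {0..T}"
        by (auto simp: space_pair_measure sp)
      have "norm (indicator {..t} s *\<^sub>R (p t \<bullet>\<bullet> g s)) \<le> norm (p t \<bullet>\<bullet> g s)"
        by (auto simp: indicator_def)
      also have "\<dots> \<le> norm (p t) * norm (g s) * K" by (rule K)
      also have "\<dots> \<le> A * B * K"
        using p(2)[OF st(2)] g(2)[OF st(1)] K(1)
        by (intro mult_right_mono mult_mono) (auto intro: order_trans[OF norm_ge_zero])
      finally show "norm (indicator {..t} s *\<^sub>R (p t \<bullet>\<bullet> g s)) \<le> A * B * K" .
    qed
  qed (rule meas)
  have "(LINT t|M. p t \<bullet>\<bullet> integral {0..t} g)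
      = (LINT t|M. LINT s|M. indicator {..t} s *\<^sub>R (p t \<bullet>\<bullet> g s))"
  proof (rule Bochner_Integration.integral_cong[OF refl])
    fix t assume "t \<in> space M"
    then have t: "t \<in> {0..T}" by (simp add: sp)
    have "integrable M (\<lambda>s. indicator {..t} s *\<^sub>R g s)"
      unfolding M_def
      using gI by (rule integrable_indicator_lebesgue_on) simp
    then have "(LINT s|M. p t \<bullet>\<bullet> (indicator {..t} s *\<^sub>R g s))
        = p t \<bullet>\<bullet> (LINT s|M. indicator {..t} s *\<^sub>R g s)"
      by (rule integral_bounded_linear[OF bounded_linear_right])
    then show "p t \<bullet>\<bullet> integral {0..t} g = (LINT s|M. indicator {..t} s *\<^sub>R (p t \<bullet>\<bullet> g s))"
      using integral_upto_eq_LINT[OF gI t] by (simp add: M_def scaleR_right)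
  qed
  also have "\<dots> = (LINT s|M. LINT t|M. indicator {..t} s *\<^sub>R (p t \<bullet>\<bullet> g s))"
    by (rule MM.Fubini_integral[OF int])
  also have "\<dots> = (LINT s|M. integral {s..T} p \<bullet>\<bullet> g s)"
  proof (rule Bochner_Integration.integral_cong[OF refl])
    fix s assume "s \<in> space M"
    then have s: "s \<in> {0..T}" by (simp add: sp)
    have eq: "indicator {..t} s = (indicator {s..} t :: real)" for t
      by (auto simp: indicator_def)
    have "integrable M (\<lambda>t. indicator {s..} t *\<^sub>R p t)"
      unfolding M_def
      using pI by (rule integrable_indicator_lebesgue_on) simp
    then have "(LINT t|M. (indicator {s..} t *\<^sub>R p t) \<bullet>\<bullet> g s)
        = (LINT t|M. indicator {s..} t *\<^sub>R p t) \<bullet>\<bullet> g s"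
      by (rule integral_bounded_linear[OF bounded_linear_left])
    then show "(LINT t|M. indicator {..t} s *\<^sub>R (p t \<bullet>\<bullet> g s)) = integral {s..T} p \<bullet>\<bullet> g s"
      using integral_from_eq_LINT[OF pI s] by (simp add: M_def scaleR_left eq)
  qed
  finally show ?thesis by (simp add: M_def)
qed

text \<open>Henstock's lemma in place of a differentiation theorem: since all integrals over
  subintervals vanish, a fine Riemann sum of \<open>norm (g t)\<close> is exactly the sum of the
  local errors, hence small. So \<open>norm (g t)\<close> has integral 0.\<close>

lemma AE_zero_of_primitive_zero:
  fixes g :: "real \<Rightarrow> 'a::euclidean_space"
  assumes g: "integrable (lebesgue_on {0..T}) g"
    and zero: "\<And>t. t \<in> {0..T} \<Longrightarrow> integral {0..t} g = 0"
  shows "AE t in lebesgue_on {0..T}. g t = 0"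
proof -
  have gI: "g integrable_on {0..T}"
    using g by (rule integrable_on_lebesgue_on) simp
  have sub: "integral {c..d} g = 0" if "{c..d} \<subseteq> {0..T}" "c \<le> d" for c d
  proof -
    have "g integrable_on {0..d}"
      by (rule integrable_on_subinterval[OF gI]) (use that in auto)
    then have "integral {0..c} g + integral {c..d} g = integral {0..d} g"
      using that by (intro Henstock_Kurzweil_Integration.integral_combine) auto
    then show ?thesis using that zero[of c] zero[of d] by auto
  qed
  have "((\<lambda>t. norm (g t)) has_integral 0) (cbox 0 T)"
    unfolding has_integral
  proof (intro allI impI)
    fix e :: real assume e: "0 < e"
    obtain \<gamma> where \<gamma>: "gauge \<gamma>"
      "\<And>p. p tagged_partial_division_of (cbox 0 T) \<Longrightarrow> \<gamma> fine p \<Longrightarrow>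
             sum (\<lambda>(x,k). norm (measure lborel k *\<^sub>R g x - integral k g)) p < e"
      by (rule Henstock_lemma[OF gI[folded cbox_interval] e], rule that)
    have "norm ((\<Sum>(x,k)\<in>p. measure lborel k *\<^sub>R norm (g x)) - 0) < e"
      if p: "p tagged_division_of cbox 0 T" "\<gamma> fine p" for p
    proof -
      have "(\<Sum>(x,k)\<in>p. measure lborel k *\<^sub>R norm (g x))
          = (\<Sum>(x,k)\<in>p. norm (measure lborel k *\<^sub>R g x - integral k g))"
      proof (rule sum.cong[OF refl], clarify)
        fix x k assume xk: "(x,k) \<in> p"
        obtain c d where k: "k = {c..d}"
          using tagged_division_ofD(4)[OF p(1) xk] by auto
        have "k \<subseteq> {0..T}" "x \<in> k"
          using tagged_division_ofD(2,3)[OF p(1) xk] by auto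
        then have "integral k g = 0"
          using k by (auto intro: sub)
        then show "measure lborel k *\<^sub>R norm (g x) = norm (measure lborel k *\<^sub>R g x - integral k g)"
          using k by simp
      qed
      moreover have "\<dots> < e"
        using p by (intro \<gamma>(2)) (simp_all add: tagged_division_of_def)
      moreover have "0 \<le> (\<Sum>(x,k)\<in>p. norm (measure lborel k *\<^sub>R g x - integral k g))"
        by (rule sum_nonneg) auto
      ultimately show ?thesis by simp
    qed
    then show "\<exists>\<gamma>. gauge \<gamma> \<and> (\<forall>\<D>. \<D> tagged_division_of cbox 0 T \<and> \<gamma> fine \<D> \<longrightarrow>
        norm ((\<Sum>(x,k)\<in>\<D>. measure lborel k *\<^sub>R norm (g x)) - 0) < e)"
      using \<gamma>(1) by blast
  qed
  moreover have "((\<lambda>t. norm (g t)) has_integral (LINT t|lebesgue_on {0..T}. norm (g t))) {0..T}"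
    using g by (intro has_integral_integral_lebesgue_on) auto
  ultimately have "(LINT t|lebesgue_on {0..T}. norm (g t)) = 0"
    unfolding cbox_interval by (rule has_integral_unique[symmetric])
  then show ?thesis
    using integral_nonneg_eq_0_iff_AE[of "lebesgue_on {0..T}" "\<lambda>t. norm (g t)"] g by simp
qed

lemma integral_inner_left:
  fixes f :: "'b::euclidean_space \<Rightarrow> 'a::euclidean_space"
  assumes "f integrable_on S"
  shows "integral S (\<lambda>t. f t \<bullet> z) = integral S f \<bullet> z" "(\<lambda>t. f t \<bullet> z) integrable_on S"
  using has_integral_linear[OF integrable_integral[OF assms] bounded_linear_inner_left[of z]]
  by (auto simp: o_def integral_unique has_integral_integrable)

lemma LINT_const_interval: "0 \<le> T \<Longrightarrow> (LINT t|lebesgue_on {0..T}. (c::real)) = T * c"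
  by (simp add: measure_restrict_space)

lemma norm_LINT_interval_le:
  fixes f :: "real \<Rightarrow> real"
  assumes "0 \<le> T" "integrable (lebesgue_on {0..T}) f" "\<And>t. t \<in> {0..T} \<Longrightarrow> norm (f t) \<le> B"
  shows "\<bar>LINT t|lebesgue_on {0..T}. f t\<bar> \<le> T * B"
proof -
  let ?M = "lebesgue_on {0..T}"
  have "\<bar>LINT t|?M. f t\<bar> \<le> (LINT t|?M. \<bar>f t\<bar>)"
    by (rule integral_abs_bound)
  also have "\<dots> \<le> (LINT t|?M. B)"
  proof (rule integral_mono)
    show "integrable ?M (\<lambda>t. B)"
      by (rule finite_measure.integrable_const[OF finite_measure_lebesgue_on]) simp
  qed (use assms in auto)
  also have "\<dots> = T * B" using assms(1) by (rule LINT_const_interval)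
  finally show ?thesis .
qed

section \<open>Weak derivatives and the lemma of du Bois-Reymond\<close>

lemma half_square_pos_part_deriv:
  "((\<lambda>x::real. (max 0 x)\<^sup>2 / 2) has_real_derivative max 0 x) (at x)"
proof -
  consider "x > 0" | "x < 0" | "x = 0" by linarith
  then show ?thesis
  proof cases
    case 1
    have "((\<lambda>x::real. x\<^sup>2 / 2) has_real_derivative x) (at x)"
      by (auto intro!: derivative_eq_intros)
    then have "((\<lambda>x::real. (max 0 x)\<^sup>2 / 2) has_real_derivative x) (at x)"
      by (rule DERIV_cong_ev[OF refl _ refl, THEN iffD1, rotated])
        (use 1 eventually_gt_at_top in \<open>auto intro!: eventually_mono[OF order_tendstoD(1)[OF tendsto_ident_at 1]] simp: eventually_nhds_conv_at\<close>)
    then show ?thesis using 1 by simp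
  next
    case 2
    have "((\<lambda>x::real. 0) has_real_derivative 0) (at x)"
      by simp
    then have "((\<lambda>x::real. (max 0 x)\<^sup>2 / 2) has_real_derivative 0) (at x)"
      by (rule DERIV_cong_ev[OF refl _ refl, THEN iffD1, rotated])
        (use 2 in \<open>auto intro!: eventually_mono[OF order_tendstoD(2)[OF tendsto_ident_at 2]] simp: eventually_nhds_conv_at\<close>)
    then show ?thesis using 2 by simp
  next
    case 3
    have "(\<lambda>h::real. (max 0 h) / 2) \<midarrow>0\<rightarrow> max 0 0 / 2"
      by (intro tendsto_intros) auto
    moreover have "((max 0 (0 + h))\<^sup>2 / 2 - (max 0 0)\<^sup>2 / 2) / h = max 0 h / 2" if "h \<noteq> 0" for h :: real
      using that by (auto simp: max_def power2_eq_square)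
    ultimately have "(\<lambda>h::real. ((max 0 (0 + h))\<^sup>2 / 2 - (max 0 0)\<^sup>2 / 2) / h) \<midarrow>0\<rightarrow> max 0 0"
      by (subst LIM_equal[where g = "\<lambda>h. max 0 h / 2"]) auto
    then show ?thesis using 3 by (simp only: DERIV_def)
  qed
qed

text \<open>The second difference of the positive part with step \<open>e\<close>: for
  \<open>e > 0\<close> a hat of height \<open>e\<close> on \<open>[-e, e]\<close>, with area
  \<open>e\<^sup>2\<close>. The same second difference of \<open>(max 0 x)\<^sup>2 / 2\<close> is
  its C^1 primitive \<open>ramp\<close>.\<close>

definition tent :: "real \<Rightarrow> real \<Rightarrow> real" where
  "tent e x = max 0 (x + e) - 2 * max 0 x + max 0 (x - e)"

definition ramp :: "real \<Rightarrow> real \<Rightarrow> real" where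
  "ramp e x = (max 0 (x + e))\<^sup>2 / 2 - 2 * ((max 0 x)\<^sup>2 / 2) + (max 0 (x - e))\<^sup>2 / 2"

lemma ramp_deriv: "((\<lambda>x. ramp e (x - s)) has_real_derivative tent e (x - s)) (at x)"
proof -
  have *: "((\<lambda>x. (max 0 (x - s + d))\<^sup>2 / 2) has_real_derivative max 0 (x - s + d)) (at x)" for d
  proof -
    have "((\<lambda>x. x - s + d) has_real_derivative 1) (at x)"
      by (auto intro!: derivative_eq_intros)
    from DERIV_chain2[where f = "\<lambda>x. (max 0 x)\<^sup>2 / 2", OF half_square_pos_part_deriv this]
    show ?thesis by simp
  qed
  show ?thesis
    unfolding ramp_def tent_def
    by (rule derivative_eq_intros *[of e] *[of 0, simplified] *[of "-e", simplified] refl)+ auto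
qed

lemma tent_nonneg: "0 < e \<Longrightarrow> 0 \<le> tent e x"
  and tent_eq_0: "0 < e \<Longrightarrow> e \<le> \<bar>x\<bar> \<Longrightarrow> tent e x = 0"
  by (auto simp: tent_def max_def)

lemma ramp_left: "0 < e \<Longrightarrow> x \<le> - e \<Longrightarrow> ramp e x = 0"
  and ramp_right: "0 < e \<Longrightarrow> e \<le> x \<Longrightarrow> ramp e x = e\<^sup>2"
  by (auto simp: ramp_def max_def power2_eq_square field_simps)

lemma continuous_on_tent: "continuous_on A (\<lambda>x. tent e (x - s))"
  unfolding tent_def by (intro continuous_intros)

lemma integral_tent:
  assumes "0 < e" "e \<le> s" "s \<le> T - e"
  shows "((\<lambda>x. tent e (x - s)) has_integral e\<^sup>2) {0..T}"
proof -
  have "((\<lambda>x. tent e (x - s)) has_integral (ramp e (T - s) - ramp e (0 - s))) {0..T}"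
    using assms
    by (intro fundamental_theorem_of_calculus has_field_derivative_at_within
        ramp_deriv[unfolded has_real_derivative_iff_has_vector_derivative]
        has_vector_derivative_at_within) auto
  then show ?thesis using assms by (simp add: ramp_left ramp_right)
qed

text \<open>The kernel is nonnegative with mass \<open>e\<^sup>2\<close> concentrated within
  \<open>e\<close> of \<open>s\<close>, so it acts as an unnormalised average.\<close>

lemma tent_average_close:
  fixes w :: "real \<Rightarrow> 'a::euclidean_space"
  assumes w: "continuous_on {0..T} w" and e: "0 < e" "e \<le> s" "s \<le> T - e"
    and d: "\<And>x. x \<in> {0..T} \<Longrightarrow> \<bar>x - s\<bar> < e \<Longrightarrow> norm (w x - w s) \<le> d"
  shows "norm (integral {0..T} (\<lambda>x. tent e (x - s) *\<^sub>R w x) - e\<^sup>2 *\<^sub>R w s) \<le> e\<^sup>2 * d"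
proof -
  have i1: "(\<lambda>x. tent e (x - s) *\<^sub>R w x) integrable_on {0..T}"
    by (intro integrable_continuous_interval continuous_intros continuous_on_tent w)
  have i2: "((\<lambda>x. tent e (x - s) *\<^sub>R w s) has_integral e\<^sup>2 *\<^sub>R w s) {0..T}"
    by (rule has_integral_scaleR_left[OF integral_tent[OF e]])
  have i3: "((\<lambda>x. tent e (x - s) * d) has_integral e\<^sup>2 * d) {0..T}"
    by (rule has_integral_mult_left[OF integral_tent[OF e]])
  have "integral {0..T} (\<lambda>x. tent e (x - s) *\<^sub>R w x) - e\<^sup>2 *\<^sub>R w s
      = integral {0..T} (\<lambda>x. tent e (x - s) *\<^sub>R w x - tent e (x - s) *\<^sub>R w s)"
    using i1 i2 by (simp add: Henstock_Kurzweil_Integration.integral_diff integral_unique has_integral_integrable)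
  also have "norm \<dots> \<le> integral {0..T} (\<lambda>x. tent e (x - s) * d)"
  proof (rule integral_norm_bound_integral)
    fix x assume x: "x \<in> {0..T}"
    show "norm (tent e (x - s) *\<^sub>R w x - tent e (x - s) *\<^sub>R w s) \<le> tent e (x - s) * d"
    proof (cases "\<bar>x - s\<bar> < e")
      case True
      then show ?thesis
        using d[OF x] tent_nonneg[OF e(1), of "x - s"]
        by (simp add: scaleR_diff_right[symmetric] mult_left_mono)
    next
      case False
      then show ?thesis using tent_eq_0[OF e(1), of "x - s"] by simp
    qed
  qed (use i1 i2 i3 in \<open>auto intro!: Henstock_Kurzweil_Integration.integrable_diff\<close>)
  also have "\<dots> = e\<^sup>2 * d" using i3 by (rule integral_unique)
  finally show ?thesis .
qed

text \<open>Testing with the difference of two ramps turns the hypothesis into equality of weighted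
  averages of \<open>w\<close> around two interior points; narrow kernels then give equal values.
  The end points follow by continuity.\<close>

lemma du_Bois_Reymond:
  fixes w :: "real \<Rightarrow> 'a::euclidean_space"
  assumes w: "continuous_on {0..T} w" and T: "0 < T"
    and zero: "\<And>\<eta>. \<eta> \<in> test_functions T \<Longrightarrow>
      (LINT t|lebesgue_on {0..T}. deriv \<eta> t *\<^sub>R w t) = 0"
    and t: "t \<in> {0..T}"
  shows "w t = w 0"
proof -
  have *: "w s = w t" if st: "s \<in> {0<..<T}" "t \<in> {0<..<T}" for s t
  proof -
    have bound: "norm (w s - w t) \<le> 2 * d" if d: "0 < d" for d
    proof -
      have "isCont w s" "isCont w t"
        using st w by (auto intro: continuous_on_interior)
      then obtain e1 e2 where e12: "e1 > 0" "e2 > 0"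
        "\<And>x. \<bar>x - s\<bar> < e1 \<Longrightarrow> norm (w x - w s) < d"
        "\<And>x. \<bar>x - t\<bar> < e2 \<Longrightarrow> norm (w x - w t) < d"
        using d unfolding continuous_at_eps_delta dist_norm real_norm_def by blast
      \<comment> \<open>The halves keep both kernels strictly inside the interval; \<open>e1\<close>
        and \<open>e2\<close> come from continuity at \<open>s\<close> and \<open>t\<close>.\<close>
      define e where "e = Min {e1, e2, s/2, t/2, (T-s)/2, (T-t)/2}"
      have "e \<in> {e1, e2, s/2, t/2, (T-s)/2, (T-t)/2}"
        unfolding e_def by (rule Min_in) auto
      moreover have "0 < x" if "x \<in> {e1, e2, s/2, t/2, (T-s)/2, (T-t)/2}" for x
        using that st e12(1,2) by auto
      ultimately have "0 < e"
        by blast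
      moreover have m: "e \<le> x" if "x \<in> {e1, e2, s/2, t/2, (T-s)/2, (T-t)/2}" for x
        unfolding e_def using that by (intro Min_le) auto
      ultimately have e: "0 < e" "e \<le> e1" "e \<le> e2" "e \<le> s/2" "e \<le> t/2"
          "e \<le> (T-s)/2" "e \<le> (T-t)/2"
        using m[of e1] m[of e2] m[of "s/2"] m[of "t/2"] m[of "(T-s)/2"] m[of "(T-t)/2"] by simp_all
      \<comment> \<open>Both ramps end at the same height \<open>e\<^sup>2\<close>, so their
        difference also vanishes to the right of both points and has compact support.\<close>
      define \<eta> where "\<eta> x = ramp e (x - s) - ramp e (x - t)" for x
      have der: "(\<eta> has_real_derivative (tent e (x - s) - tent e (x - t))) (at x)" for x
        unfolding \<eta>_def by (intro DERIV_diff ramp_deriv)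
      have "\<eta> \<in> test_functions T"
      proof -
        have "\<eta> C1_differentiable_on UNIV"
          unfolding C1_differentiable_on_def
          using der by (intro exI[of _ "\<lambda>x. tent e (x - s) - tent e (x - t)"])
            (auto simp: has_real_derivative_iff_has_vector_derivative intro!: continuous_intros continuous_on_tent)
        moreover have "{x. \<eta> x \<noteq> 0} \<subseteq> {min s t - e..max s t + e}"
        proof
          fix x assume "x \<in> {x. \<eta> x \<noteq> 0}"
          then have nz: "\<eta> x \<noteq> 0" by simp
          have "\<not> x < min s t - e"
            using nz ramp_left[OF e(1), of "x - s"] ramp_left[OF e(1), of "x - t"] by (auto simp: \<eta>_def)
          moreover have "\<not> x > max s t + e"
            using nz ramp_right[OF e(1), of "x - s"] ramp_right[OF e(1), of "x - t"] by (auto simp: \<eta>_def)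
          ultimately show "x \<in> {min s t - e..max s t + e}" by auto
        qed
        then have "closure {x. \<eta> x \<noteq> 0} \<subseteq> {min s t - e..max s t + e}"
          by (rule closure_minimal) simp
        moreover have "{min s t - e..max s t + e} \<subseteq> {0<..<T}"
          using e st by (auto simp: min_def max_def split: if_splits)
        ultimately show ?thesis by (auto simp: test_functions_def)
      qed
      moreover have "deriv \<eta> = (\<lambda>x. tent e (x - s) - tent e (x - t))"
        by (intro ext DERIV_imp_deriv der)
      ultimately have "(LINT x|lebesgue_on {0..T}. (tent e (x - s) - tent e (x - t)) *\<^sub>R w x) = 0"
        using zero[of \<eta>] by simp
      moreover have cont: "continuous_on {0..T} (\<lambda>x. (tent e (x - s) - tent e (x - t)) *\<^sub>R w x)"
        by (intro continuous_intros continuous_on_tent w)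
      then have "integrable (lebesgue_on {0..T}) (\<lambda>x. (tent e (x - s) - tent e (x - t)) *\<^sub>R w x)"
        by (intro absolutely_integrable_imp_integrable absolutely_integrable_continuous_real) auto
      ultimately have "integral {0..T} (\<lambda>x. (tent e (x - s) - tent e (x - t)) *\<^sub>R w x) = 0"
        by (simp add: LINT_interval_eq_integral)
      then have eq: "integral {0..T} (\<lambda>x. tent e (x - s) *\<^sub>R w x) = integral {0..T} (\<lambda>x. tent e (x - t) *\<^sub>R w x)"
        by (simp add: scaleR_diff_left) (subst (asm) Henstock_Kurzweil_Integration.integral_diff,
            auto intro!: integrable_continuous_interval continuous_intros continuous_on_tent w)
      have 1: "norm (integral {0..T} (\<lambda>x. tent e (x - s) *\<^sub>R w x) - e\<^sup>2 *\<^sub>R w s) \<le> e\<^sup>2 * d"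
        using e st e12 by (intro tent_average_close w) (auto intro: less_imp_le)
      have 2: "norm (integral {0..T} (\<lambda>x. tent e (x - t) *\<^sub>R w x) - e\<^sup>2 *\<^sub>R w t) \<le> e\<^sup>2 * d"
        using e st e12 by (intro tent_average_close w) (auto intro: less_imp_le)
      have "norm (e\<^sup>2 *\<^sub>R w s - e\<^sup>2 *\<^sub>R w t) \<le> e\<^sup>2 * d + e\<^sup>2 * d"
        using norm_triangle_le_diff[OF add_mono[OF 2 1]] unfolding eq by simp
      then have "e\<^sup>2 * norm (w s - w t) \<le> e\<^sup>2 * (2 * d)"
        by (simp add: scaleR_diff_right[symmetric] mult.commute)
      then show ?thesis using e(1) by simp
    qed
    have "norm (w s - w t) \<le> 0"
      by (rule field_le_epsilon) (use bound[of "_ / 2"] in simp)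
    then show ?thesis by simp
  qed
  have cont: "continuous_on (closure {0<..<T}) w"
    using w T by simp
  have const: "w x = w (T/2)" if "x \<in> {0<..<T}" for x
    by (rule *) (use that T in auto)
  have "w x = w (T/2)" if "x \<in> {0..T}" for x
    using continuous_constant_on_closure[OF cont const, of x] that T by simp
  from this[of t] this[of 0] show ?thesis using t T by simp
qed

text \<open>The working form of \<open>v \<in> K_set T a\<close>, with an explicit slope
  \<open>g\<close>. The bound is required at every point, not almost everywhere, so that
  \<open>\<Phi> (g t)\<close> is always evaluated in the closed ball, where \<open>\<Phi>\<close> is
  continuous.\<close>

definition primitive_on ::
  "real \<Rightarrow> real \<Rightarrow> (real \<Rightarrow> 'a::euclidean_space) \<Rightarrow> (real \<Rightarrow> 'a) \<Rightarrow> bool" where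
  "primitive_on T a v g \<longleftrightarrow> g \<in> borel_measurable (lebesgue_on {0..T}) \<and>
    (\<forall>t\<in>{0..T}. norm (g t) \<le> a) \<and> (\<forall>t\<in>{0..T}. v t = v 0 + integral {0..t} g)"

lemma primitive_onI:
  assumes "g \<in> borel_measurable (lebesgue_on {0..T})" "\<And>t. t \<in> {0..T} \<Longrightarrow> norm (g t) \<le> a"
    and "\<And>t. t \<in> {0..T} \<Longrightarrow> v t = v 0 + integral {0..t} g"
  shows "primitive_on T a v g"
  unfolding primitive_on_def using assms by blast

lemma primitive_on_measurable: "primitive_on T a v g \<Longrightarrow> g \<in> borel_measurable (lebesgue_on {0..T})"
  and primitive_on_bound: "primitive_on T a v g \<Longrightarrow> t \<in> {0..T} \<Longrightarrow> norm (g t) \<le> a"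
  and primitive_on_eq: "primitive_on T a v g \<Longrightarrow> t \<in> {0..T} \<Longrightarrow> v t = v 0 + integral {0..t} g"
  unfolding primitive_on_def by blast+

lemma primitive_on_integrable:
  "primitive_on T a v g \<Longrightarrow> integrable (lebesgue_on {0..T}) g"
  by (blast intro: integrable_bounded_interval primitive_on_measurable primitive_on_bound)

lemma primitive_on_integrable_on:
  "primitive_on T a v g \<Longrightarrow> g integrable_on {0..T}"
  by (rule integrable_on_lebesgue_on[OF primitive_on_integrable]) auto

lemma primitive_on_diff:
  assumes "primitive_on T a v g" "0 \<le> s" "s \<le> t" "t \<le> T"
  shows "v t - v s = integral {s..t} g"
proof -
  have "g integrable_on {0..t}"
    by (rule integrable_on_subinterval[OF primitive_on_integrable_on[OF assms(1)]]) (use assms in auto)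
  then have "integral {0..s} g + integral {s..t} g = integral {0..t} g"
    using assms by (intro Henstock_Kurzweil_Integration.integral_combine) auto
  then show ?thesis
    using primitive_on_eq[OF assms(1), of s] primitive_on_eq[OF assms(1), of t] assms
    by (simp add: algebra_simps)
qed

lemma primitive_on_Lipschitz:
  assumes "primitive_on T a v g" "s \<in> {0..T}" "t \<in> {0..T}"
  shows "norm (v t - v s) \<le> a * \<bar>t - s\<bar>"
proof -
  have *: "norm (v t - v s) \<le> a * (t - s)" if "0 \<le> s" "s \<le> t" "t \<le> T" for s t
  proof -
    have "g integrable_on cbox s t"
      using integrable_on_subinterval[OF primitive_on_integrable_on[OF assms(1)], of s t] that by auto
    moreover have "0 \<le> a"
      using primitive_on_bound[OF assms(1), of s] that by (auto intro: order_trans[OF norm_ge_zero])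
    ultimately have "norm (integral (cbox s t) g) \<le> a * measure lborel (cbox s t)"
      using that by (intro integrable_bound primitive_on_bound[OF assms(1)]) auto
    then show ?thesis using primitive_on_diff[OF assms(1) that] that by simp
  qed
  show ?thesis
    using *[of s t] *[of t s] assms by (cases "s \<le> t") (auto simp: norm_minus_commute)
qed

lemma primitive_on_continuous:
  assumes "primitive_on T a v g"
  shows "continuous_on {0..T} v"
proof -
  have "continuous_on {0..T} (\<lambda>t. v 0 + integral {0..t} g)"
    by (intro continuous_intros indefinite_integral_continuous_1 primitive_on_integrable_on[OF assms])
  then show ?thesis
    by (rule continuous_on_eq) (rule primitive_on_eq[OF assms, symmetric])
qed

lemma continuous_interval_measurable_bounded:
  fixes f :: "real \<Rightarrow> 'a::euclidean_space"
  assumes "continuous_on {0..T} f"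
  shows "f \<in> borel_measurable (lebesgue_on {0..T})"
    and "\<exists>B. \<forall>t\<in>{0..T}. norm (f t) \<le> B"
    and "integrable (lebesgue_on {0..T}) f"
proof -
  show 1: "f \<in> borel_measurable (lebesgue_on {0..T})"
    by (rule continuous_imp_measurable_on_sets_lebesgue[OF assms]) simp
  have "bounded (f ` {0..T})"
    by (intro compact_imp_bounded compact_continuous_image assms) simp
  then show 2: "\<exists>B. \<forall>t\<in>{0..T}. norm (f t) \<le> B"
    by (auto simp: bounded_iff)
  then show "integrable (lebesgue_on {0..T}) f"
    using integrable_bounded_interval[OF 1] by blast
qed

section \<open>Weak derivatives and slopes of primitives\<close>

lemma test_functionsD:
  assumes "\<eta> \<in> test_functions T"
  shows "(\<eta> has_real_derivative deriv \<eta> t) (at t)"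
    and "continuous_on A (deriv \<eta>)" and "continuous_on A \<eta>"
    and "t \<notin> {0<..<T} \<Longrightarrow> \<eta> t = 0"
proof -
  obtain D where D: "\<And>t. (\<eta> has_vector_derivative D t) (at t)" "continuous_on UNIV D"
    using assms by (auto simp: test_functions_def C1_differentiable_on_def)
  then have D': "(\<eta> has_real_derivative D t) (at t)" for t
    by (simp add: has_real_derivative_iff_has_vector_derivative)
  then have eq: "deriv \<eta> = D"
    by (intro ext DERIV_imp_deriv)
  show "(\<eta> has_real_derivative deriv \<eta> t) (at t)" using D' eq by simp
  show "continuous_on A (deriv \<eta>)" using D(2) eq continuous_on_subset by auto
  show "continuous_on A \<eta>"
    using D' by (meson DERIV_isCont continuous_at_imp_continuous_on)
  show "\<eta> t = 0" if "t \<notin> {0<..<T}"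
    using assms that closure_subset[of "{t. \<eta> t \<noteq> 0}"] by (auto simp: test_functions_def)
qed

lemma integral_deriv_test_function:
  assumes "\<eta> \<in> test_functions T" "s \<le> T"
  shows "(deriv \<eta> has_integral - \<eta> s) {s..T}"
proof -
  have "(deriv \<eta> has_integral (\<eta> T - \<eta> s)) {s..T}"
    by (rule fundamental_theorem_of_calculus[OF assms(2)]) (rule has_vector_derivative_at_within[OF
        test_functionsD(1)[OF assms(1), unfolded has_real_derivative_iff_has_vector_derivative]])
  then show ?thesis using test_functionsD(4)[OF assms(1), of T] by simp
qed

text \<open>Integration by parts with \<open>p = deriv \<eta>\<close>, whose integral from
  \<open>s\<close> to \<open>T\<close> is \<open>- \<eta> s\<close>; the constant \<open>v 0\<close>
  contributes nothing because \<open>\<eta>\<close> vanishes at both ends.\<close>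

lemma primitive_on_imp_weak_deriv:
  assumes v: "primitive_on T a v g" and T: "0 < T"
  shows "is_weak_deriv T v g"
  unfolding is_weak_deriv_def
proof
  fix \<eta> assume \<eta>: "\<eta> \<in> test_functions T"
  let ?M = "lebesgue_on {0..T}"
  note cont = test_functionsD(2)[OF \<eta>, of "{0..T}"]
  obtain A where A: "\<And>t. t \<in> {0..T} \<Longrightarrow> norm (deriv \<eta> t) \<le> A"
    using continuous_interval_measurable_bounded(2)[OF cont] by blast
  have int0: "integrable ?M (\<lambda>t. deriv \<eta> t *\<^sub>R v 0)"
    by (intro continuous_interval_measurable_bounded continuous_intros cont)
  have int1: "integrable ?M (\<lambda>t. deriv \<eta> t *\<^sub>R integral {0..t} g)"
    by (intro continuous_interval_measurable_bounded continuous_intros cont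
        indefinite_integral_continuous_1 primitive_on_integrable_on[OF v])
  have "(LINT t|?M. deriv \<eta> t *\<^sub>R v t)
      = (LINT t|?M. deriv \<eta> t *\<^sub>R v 0 + deriv \<eta> t *\<^sub>R integral {0..t} g)"
    by (intro Bochner_Integration.integral_cong refl)
      (simp add: scaleR_add_right[symmetric] primitive_on_eq[OF v, symmetric] del: scaleR_add_right)
  also have "\<dots> = (LINT t|?M. deriv \<eta> t *\<^sub>R v 0) + (LINT t|?M. deriv \<eta> t *\<^sub>R integral {0..t} g)"
    by (rule Bochner_Integration.integral_add[OF int0 int1])
  also have "(LINT t|?M. deriv \<eta> t *\<^sub>R v 0) = 0"
    using has_integral_scaleR_left[OF integral_deriv_test_function[OF \<eta>, of 0], of "v 0"] T
      test_functionsD(4)[OF \<eta>, of 0]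
    by (subst LINT_interval_eq_integral[OF int0]) (simp add: integral_unique)
  also have "(LINT t|?M. deriv \<eta> t *\<^sub>R integral {0..t} g)
      = (LINT s|?M. integral {s..T} (deriv \<eta>) *\<^sub>R g s)"
    by (rule integral_by_parts_bilinear[OF bounded_bilinear_scaleR
        continuous_interval_measurable_bounded(1)[OF cont] A
        primitive_on_measurable[OF v] primitive_on_bound[OF v]])
  also have "\<dots> = (LINT s|?M. - (\<eta> s *\<^sub>R g s))"
    by (intro Bochner_Integration.integral_cong)
      (auto simp: integral_unique[OF integral_deriv_test_function[OF \<eta>]])
  finally show "(LINT t|?M. deriv \<eta> t *\<^sub>R v t) = - (LINT t|?M. \<eta> t *\<^sub>R g t)"
    by simp
qed

text \<open>\<open>v\<close> and the primitive of a truncated \<open>h\<close> have the same weak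
  derivative, so their difference is constant by \<open>du_Bois_Reymond\<close>.\<close>

lemma primitive_on_of_weak_deriv:
  fixes v h :: "real \<Rightarrow> 'a::euclidean_space"
  assumes v: "continuous_on {0..T} v" and T: "0 < T" and B: "0 \<le> B"
    and h: "h \<in> borel_measurable (lebesgue_on {0..T})" "AE t in lebesgue_on {0..T}. norm (h t) \<le> B"
    and wd: "is_weak_deriv T v h"
  obtains g where "primitive_on T B v g" "AE t in lebesgue_on {0..T}. h t = g t"
proof
  let ?M = "lebesgue_on {0..T}"
  \<comment> \<open>Alters \<open>h\<close> on a null set only and makes the bound hold everywhere;
    the default 0 is admissible since \<open>0 \<le> B\<close>.\<close>
  define g where "g t = (if norm (h t) \<le> B then h t else 0)" for t
  note h(1)[measurable]
  have g: "g \<in> borel_measurable ?M" "\<And>t. norm (g t) \<le> B"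
    using B unfolding g_def by (measurable, auto)
  show ae: "AE t in ?M. h t = g t"
    using h(2) by eventually_elim (simp add: g_def)
  define G where "G t = integral {0..t} g" for t
  have G: "primitive_on T B G g"
    using g by (auto simp: primitive_on_def G_def)
  have *: "v t - G t = v 0 - G 0" if t: "t \<in> {0..T}" for t
  proof (rule du_Bois_Reymond[OF _ T _ t])
    show "continuous_on {0..T} (\<lambda>t. v t - G t)"
      by (intro continuous_intros v primitive_on_continuous[OF G])
    fix \<eta> assume \<eta>: "\<eta> \<in> test_functions T"
    note [measurable] = continuous_interval_measurable_bounded(1)[OF test_functionsD(3)[OF \<eta>]] g(1)
    have "(LINT t|?M. \<eta> t *\<^sub>R h t) = (LINT t|?M. \<eta> t *\<^sub>R g t)"
      by (rule integral_cong_AE) (measurable, use ae in eventually_elim, simp)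
    then have "(LINT t|?M. deriv \<eta> t *\<^sub>R v t) = (LINT t|?M. deriv \<eta> t *\<^sub>R G t)"
      using wd primitive_on_imp_weak_deriv[OF G T] \<eta> by (simp add: is_weak_deriv_def)
    moreover have "integrable ?M (\<lambda>t. deriv \<eta> t *\<^sub>R v t)" "integrable ?M (\<lambda>t. deriv \<eta> t *\<^sub>R G t)"
      by (intro continuous_interval_measurable_bounded continuous_intros test_functionsD(2)[OF \<eta>]
          v primitive_on_continuous[OF G])+
    ultimately show "(LINT t|?M. deriv \<eta> t *\<^sub>R (v t - G t)) = 0"
      by (simp add: scaleR_diff_right)
  qed
  have "v t = v 0 + integral {0..t} g" if "t \<in> {0..T}" for t
    using *[OF that] by (simp add: G_def algebra_simps)
  then show "primitive_on T B v g"
    using g by (intro primitive_onI)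
qed

text \<open>Completeness of Lebesgue measure. The selected \<open>weak_deriv\<close> may leave the
  closed ball on a null set, where \<open>\<Phi>\<close> is arbitrary, so measurability of the
  composition cannot be read off from continuity.\<close>

lemma measurable_of_AE_eq_lebesgue_on:
  fixes f g :: "real \<Rightarrow> 'a::euclidean_space"
  assumes f: "f \<in> borel_measurable (lebesgue_on S)" and S: "S \<in> sets lebesgue"
    and ae: "AE x in lebesgue_on S. f x = g x"
  shows "g \<in> borel_measurable (lebesgue_on S)"
proof -
  have "AE x in lebesgue. x \<in> S \<longrightarrow> f x = g x"
    using ae S by (simp add: AE_restrict_space_iff)
  then have ae': "AE x in lebesgue. (if x \<in> S then f x else 0) = (if x \<in> S then g x else 0)"
    by eventually_elim auto
  have "(\<lambda>x. if x \<in> S then g x else 0) \<in> borel_measurable lebesgue"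
    by (rule borel_measurable_AE[OF _ ae']) (rule borel_measurable_if[OF S, THEN iffD2, OF f])
  then show ?thesis by (rule borel_measurable_if[OF S, THEN iffD1])
qed

lemma borel_measurable_continuous_on_compose:
  assumes \<Phi>: "continuous_on C \<Phi>" and g: "g \<in> borel_measurable M" "\<And>t. t \<in> space M \<Longrightarrow> g t \<in> C"
  shows "(\<lambda>t. \<Phi> (g t)) \<in> borel_measurable M"
  using measurable_compose[OF measurable_restrict_space2[OF _ g(1)] borel_measurable_continuous_on_restrict[OF \<Phi>]]
    g(2) by auto

lemma AE_norm_le_of_Linf_norm:
  assumes "Linf_norm T h \<le> ereal B"
  shows "AE t in lebesgue_on {0..T}. norm (h t) \<le> B"
  using esssup_AE[of "\<lambda>t. ereal (norm (h t))" "lebesgue_on {0..T}"]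
proof eventually_elim
  case (elim t)
  then have "ereal (norm (h t)) \<le> ereal B"
    using assms unfolding Linf_norm_def by (rule order_trans)
  then show ?case by simp
qed

lemma Linf_normI:
  assumes "h \<in> borel_measurable (lebesgue_on {0..T})" "AE t in lebesgue_on {0..T}. norm (h t) \<le> B"
  shows "Linf_norm T h \<le> ereal B"
  unfolding Linf_norm_def using assms by (intro esssup_I) auto

lemma Linf_spaceI:
  assumes "h \<in> borel_measurable (lebesgue_on {0..T})" "AE t in lebesgue_on {0..T}. norm (h t) \<le> B"
  shows "h \<in> Linf_space T"
  unfolding Linf_space_def using assms Linf_normI[OF assms] by (auto simp: le_less_trans[of _ "ereal B"])

lemma weak_deriv_spec:
  assumes "v \<in> W1inf_space T"
  shows "weak_deriv T v \<in> Linf_space T" "is_weak_deriv T v (weak_deriv T v)"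
  using someI_ex[of "\<lambda>g. g \<in> Linf_space T \<and> is_weak_deriv T v g"] assms
  by (auto simp: W1inf_space_def weak_deriv_def)

lemma K_set_imp_primitive_on:
  assumes v: "v \<in> K_set T a" and T: "0 < T" and a: "0 \<le> a"
  obtains g where "primitive_on T a v g"
proof -
  have W: "v \<in> W1inf_space T" and c: "continuous_on {0..T} v"
    and b: "Linf_norm T (weak_deriv T v) \<le> ereal a"
    using v by (auto simp: K_set_def C_space_def)
  show thesis
    using primitive_on_of_weak_deriv[OF c T a _ AE_norm_le_of_Linf_norm[OF b] weak_deriv_spec(2)[OF W]]
      weak_deriv_spec(1)[OF W] that by (auto simp: Linf_space_def)
qed

text \<open>Uniqueness of the weak derivative: the selected representative agrees almost everywhere
  with a slope having the same primitive as \<open>g\<close>, and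
  \<open>AE_zero_of_primitive_zero\<close> identifies the two.\<close>

lemma primitive_on_imp_K_set:
  assumes v: "primitive_on T a v g" and T: "0 < T"
  shows "v \<in> K_set T a" and "AE t in lebesgue_on {0..T}. weak_deriv T v t = g t"
proof -
  let ?M = "lebesgue_on {0..T}"
  let ?h = "weak_deriv T v"
  have c: "continuous_on {0..T} v" by (rule primitive_on_continuous[OF v])
  obtain B where B: "\<And>t. t \<in> {0..T} \<Longrightarrow> norm (v t) \<le> B"
    using continuous_interval_measurable_bounded(2)[OF c] by blast
  have "v \<in> Linf_space T"
    using B by (intro Linf_spaceI[where B=B] continuous_interval_measurable_bounded c AE_I2) auto
  moreover have "g \<in> Linf_space T"
    using primitive_on_measurable[OF v] primitive_on_bound[OF v]
    by (intro Linf_spaceI[where B=a] AE_I2) auto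
  ultimately have W: "v \<in> W1inf_space T"
    using primitive_on_imp_weak_deriv[OF v T] by (auto simp: W1inf_space_def)
  have h: "?h \<in> borel_measurable ?M" "Linf_norm T ?h < \<infinity>"
    using weak_deriv_spec(1)[OF W] by (auto simp: Linf_space_def)
  \<comment> \<open>So far the representative is only known to be essentially bounded; the constant
    \<open>a\<close> is recovered once it has been identified with \<open>g\<close>.\<close>
  obtain B' :: real where B': "Linf_norm T ?h \<le> ereal B'" "0 \<le> B'"
  proof (cases "Linf_norm T ?h")
    case (real r)
    then show thesis using that[of "max 0 r"] by auto
  qed (use h that[of 0] in auto)
  obtain g' where g': "primitive_on T B' v g'" "AE t in ?M. ?h t = g' t"
    by (rule primitive_on_of_weak_deriv[OF c T B'(2) h(1) AE_norm_le_of_Linf_norm[OF B'(1)]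
          weak_deriv_spec(2)[OF W]])
  have "AE t in ?M. g' t - g t = 0"
  proof (rule AE_zero_of_primitive_zero)
    show "integrable ?M (\<lambda>t. g' t - g t)"
      by (intro Bochner_Integration.integrable_diff primitive_on_integrable[OF v] primitive_on_integrable[OF g'(1)])
    fix t assume t: "t \<in> {0..T}"
    have "g integrable_on {0..t}" "g' integrable_on {0..t}"
      using integrable_on_subinterval[OF primitive_on_integrable_on[OF v], of 0 t]
        integrable_on_subinterval[OF primitive_on_integrable_on[OF g'(1)], of 0 t] t by auto
    then show "integral {0..t} (\<lambda>t. g' t - g t) = 0"
      using primitive_on_eq[OF v t] primitive_on_eq[OF g'(1) t]
      by (simp add: Henstock_Kurzweil_Integration.integral_diff)
  qed
  with g'(2) show ae: "AE t in ?M. ?h t = g t"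
    by eventually_elim simp
  have "AE t in ?M. norm (?h t) \<le> a"
    using ae AE_space by eventually_elim (use primitive_on_bound[OF v] in auto)
  then show "v \<in> K_set T a"
    using W c Linf_normI[OF h(1)] by (auto simp: K_set_def C_space_def)
qed

lemma integrable_compose_primitive_on:
  fixes \<Phi> :: "'a::euclidean_space \<Rightarrow> real"
  assumes "primitive_on T a v g" and \<Phi>: "continuous_on (cball 0 a) \<Phi>"
  shows "integrable (lebesgue_on {0..T}) (\<lambda>t. \<Phi> (g t))"
proof -
  have "bounded (\<Phi> ` cball 0 a)"
    by (intro compact_imp_bounded compact_continuous_image \<Phi>) simp
  then obtain B where "\<And>x. x \<in> cball 0 a \<Longrightarrow> norm (\<Phi> x) \<le> B"
    unfolding bounded_iff by blast
  then show ?thesis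
    using primitive_on_bound[OF assms(1)] primitive_on_measurable[OF assms(1)]
    by (intro integrable_bounded_interval[where B=B] borel_measurable_continuous_on_compose[OF \<Phi>]) auto
qed

text \<open>Removes the choice hidden in \<open>weak_deriv\<close>: any slope computes the
  functional, so the later arguments can work with slopes alone.\<close>

lemma Psi_fun_primitive_on:
  fixes \<Phi> :: "'a::euclidean_space \<Rightarrow> real"
  assumes v: "primitive_on T a v g" and T: "0 < T" and \<Phi>: "continuous_on (cball 0 a) \<Phi>"
  shows "Psi_fun T a \<Phi> v = ereal ((LINT t|lebesgue_on {0..T}. \<Phi> (g t)) - T * \<Phi> 0)"
proof -
  let ?M = "lebesgue_on {0..T}"
  have int: "integrable ?M (\<lambda>t. \<Phi> (g t))"
    by (rule integrable_compose_primitive_on[OF v \<Phi>])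
  have ae: "AE t in ?M. \<Phi> (g t) - \<Phi> 0 = \<Phi> (weak_deriv T v t) - \<Phi> 0"
    using primitive_on_imp_K_set(2)[OF v T] by eventually_elim simp
  have meas: "(\<lambda>t. \<Phi> (g t) - \<Phi> 0) \<in> borel_measurable ?M"
    using int by auto
  have "(LINT t|?M. \<Phi> (weak_deriv T v t) - \<Phi> 0) = (LINT t|?M. \<Phi> (g t) - \<Phi> 0)"
    by (rule integral_cong_AE[OF measurable_of_AE_eq_lebesgue_on[OF meas _ ae] meas])
      (use ae in \<open>auto elim: eventually_mono\<close>)
  also have "\<dots> = (LINT t|?M. \<Phi> (g t)) - T * \<Phi> 0"
    using int T finite_measure.integrable_const[OF finite_measure_lebesgue_on, of "{0..T}"]
    by (subst Bochner_Integration.integral_diff) (auto simp: LINT_const_interval simp del: lebesgue_integral_const)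
  finally show ?thesis
    using primitive_on_imp_K_set(1)[OF v T] by (simp add: Psi_fun_def)
qed

section \<open>Lower semicontinuity\<close>

lemma primitive_on_convex_combination:
  assumes v: "primitive_on T a v g" and w: "primitive_on T a w h" and s: "0 \<le> s" "s \<le> 1"
  shows "primitive_on T a (\<lambda>t. (1 - s) *\<^sub>R v t + s *\<^sub>R w t) (\<lambda>t. (1 - s) *\<^sub>R g t + s *\<^sub>R h t)"
proof (rule primitive_onI)
  show "(\<lambda>t. (1 - s) *\<^sub>R g t + s *\<^sub>R h t) \<in> borel_measurable (lebesgue_on {0..T})"
    using primitive_on_measurable[OF v] primitive_on_measurable[OF w] by measurable
  fix t assume t: "t \<in> {0..T}"
  have "g t \<in> cball 0 a" "h t \<in> cball 0 a"
    using primitive_on_bound[OF v t] primitive_on_bound[OF w t] by auto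
  then have "(1 - s) *\<^sub>R g t + s *\<^sub>R h t \<in> cball 0 a"
    using s by (intro convexD[OF convex_cball]) auto
  then show "norm ((1 - s) *\<^sub>R g t + s *\<^sub>R h t) \<le> a" by simp
  have "g integrable_on {0..t}" "h integrable_on {0..t}"
    using integrable_on_subinterval[OF primitive_on_integrable_on[OF v], of 0 t]
      integrable_on_subinterval[OF primitive_on_integrable_on[OF w], of 0 t] t by auto
  then have "integral {0..t} (\<lambda>t. (1 - s) *\<^sub>R g t + s *\<^sub>R h t)
      = (1 - s) *\<^sub>R integral {0..t} g + s *\<^sub>R integral {0..t} h"
    by (simp add: Henstock_Kurzweil_Integration.integral_add integrable_cmul)
  then show "(1 - s) *\<^sub>R v t + s *\<^sub>R w t
      = (1 - s) *\<^sub>R v 0 + s *\<^sub>R w 0 + integral {0..t} (\<lambda>t. (1 - s) *\<^sub>R g t + s *\<^sub>R h t)"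
    unfolding primitive_on_eq[OF v t] primitive_on_eq[OF w t] by (simp add: scaleR_add_right)
qed

lemma LINT_convex_combination_le:
  fixes \<Phi> :: "'a::euclidean_space \<Rightarrow> real"
  assumes v: "primitive_on T a v g" and w: "primitive_on T a w h" and s: "0 \<le> s" "s \<le> 1"
    and \<Phi>: "continuous_on (cball 0 a) \<Phi>" "convex_on (cball 0 a) \<Phi>"
  shows "(LINT t|lebesgue_on {0..T}. \<Phi> ((1 - s) *\<^sub>R g t + s *\<^sub>R h t))
    \<le> (1 - s) * (LINT t|lebesgue_on {0..T}. \<Phi> (g t)) + s * (LINT t|lebesgue_on {0..T}. \<Phi> (h t))"
proof -
  let ?M = "lebesgue_on {0..T}"
  note i1 = integrable_compose_primitive_on[OF v \<Phi>(1)]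
  note i2 = integrable_compose_primitive_on[OF w \<Phi>(1)]
  note i3 = integrable_compose_primitive_on[OF primitive_on_convex_combination[OF v w s] \<Phi>(1)]
  have "(LINT t|?M. \<Phi> ((1 - s) *\<^sub>R g t + s *\<^sub>R h t)) \<le> (LINT t|?M. (1 - s) * \<Phi> (g t) + s * \<Phi> (h t))"
  proof (rule integral_mono[OF i3])
    show "integrable ?M (\<lambda>t. (1 - s) * \<Phi> (g t) + s * \<Phi> (h t))"
      using i1 i2 by simp
    fix t assume "t \<in> space ?M"
    then show "\<Phi> ((1 - s) *\<^sub>R g t + s *\<^sub>R h t) \<le> (1 - s) * \<Phi> (g t) + s * \<Phi> (h t)"
      using primitive_on_bound[OF v] primitive_on_bound[OF w] s
      by (intro convex_onD[OF \<Phi>(2)]) auto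
  qed
  also have "\<dots> = (1 - s) * (LINT t|?M. \<Phi> (g t)) + s * (LINT t|?M. \<Phi> (h t))"
    using i1 i2 by simp
  finally show ?thesis .
qed

lemma integrable_norm_square_primitive_on:
  assumes "primitive_on T a v g"
  shows "integrable (lebesgue_on {0..T}) (\<lambda>t. (norm (g t))\<^sup>2)"
  by (rule integrable_compose_primitive_on[OF assms]) (intro continuous_intros)

text \<open>
  Near-minimisers of the \<open>L\<^sup>2\<close> norm over shrinking convex sets of competitors form an \<open>L\<^sup>2\<close> Cauchy
  sequence by the parallelogram identity. This replaces weak compactness and Mazur's lemma: the
  limit is at once a derivative of \<open>u\<close> and a witness for lower semicontinuity.
\<close>

lemma primitive_on_limit:
  fixes u :: "real \<Rightarrow> 'a::euclidean_space" and \<Phi> :: "'a \<Rightarrow> real"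
  assumes T: "0 < T" and v: "\<And>n::nat. primitive_on T a (v n) (g n)"
    and conv: "\<And>e. 0 < e \<Longrightarrow> \<exists>N. \<forall>n\<ge>N. \<forall>t\<in>{0..T}. norm (v n t - u t) \<le> e"
    and \<Phi>: "continuous_on (cball 0 a) \<Phi>" "convex_on (cball 0 a) \<Phi>"
    and lim: "(\<lambda>n. LINT t|lebesgue_on {0..T}. \<Phi> (g n t)) \<longlonglongrightarrow> A"
  obtains h where "primitive_on T a u h" "(LINT t|lebesgue_on {0..T}. \<Phi> (h t)) \<le> A"
proof -
  let ?M = "lebesgue_on {0..T}"
  \<comment> \<open>Convex because each of its conditions is, shrinking with \<open>e\<close>, and
    nonempty for \<open>e > 0\<close> because it contains late members of the sequence
    \<open>g\<close>.\<close>
  define D where "D e = {h. \<exists>w. primitive_on T a w h \<and> (\<forall>t\<in>{0..T}. norm (w t - u t) \<le> e) \<and>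
      (LINT t|?M. \<Phi> (h t)) \<le> A + e}" for e
  define N where "N h = (LINT t|?M. (norm (h t))\<^sup>2)" for h :: "real \<Rightarrow> 'a"
  define \<epsilon> where "\<epsilon> k = 1 / real (Suc k)" for k
  define m where "m k = (INF h\<in>D (\<epsilon> k). N h)" for k
  have a: "0 \<le> a"
    using primitive_on_bound[OF v, of 0 0] T by (auto intro: order_trans[OF norm_ge_zero])
  have \<epsilon>: "0 < \<epsilon> k" for k by (simp add: \<epsilon>_def)
  have \<epsilon>_anti: "\<epsilon> l \<le> \<epsilon> k" if "k \<le> l" for k l
    using that by (simp add: \<epsilon>_def field_simps)
  have \<epsilon>_lim: "\<epsilon> \<longlonglongrightarrow> 0"
    unfolding \<epsilon>_def by (rule LIMSEQ_Suc) (rule lim_1_over_n)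
  have D_ne: "D e \<noteq> {}" if e: "0 < e" for e
  proof -
    obtain N1 where N1: "\<And>n. n \<ge> N1 \<Longrightarrow> (\<forall>t\<in>{0..T}. norm (v n t - u t) \<le> e)"
      using conv[OF e] by blast
    have "\<forall>\<^sub>F n in sequentially. (LINT t|?M. \<Phi> (g n t)) < A + e"
      using lim e by (intro order_tendstoD) auto
    then obtain N2 where "\<And>n. n \<ge> N2 \<Longrightarrow> (LINT t|?M. \<Phi> (g n t)) < A + e"
      unfolding eventually_sequentially by blast
    then have "(LINT t|?M. \<Phi> (g (max N1 N2) t)) \<le> A + e"
      by (simp add: less_imp_le)
    with N1[of "max N1 N2"] v[of "max N1 N2"] show ?thesis
      unfolding D_def by auto
  qed
  have D_mono: "D e \<subseteq> D e'" if "e \<le> e'" for e e'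
  proof
    fix h assume "h \<in> D e"
    then obtain w where "primitive_on T a w h" "\<forall>t\<in>{0..T}. norm (w t - u t) \<le> e"
      "(LINT t|?M. \<Phi> (h t)) \<le> A + e"
      unfolding D_def by blast
    then show "h \<in> D e'"
      using that unfolding D_def by force
  qed
  have D_prim: "\<exists>w. primitive_on T a w h" if "h \<in> D e" for h e
    using that unfolding D_def by blast
  \<comment> \<open>The weight \<open>1 - 1/2\<close> is left unsimplified to match the general
    convex combination.\<close>
  have D_mid: "(\<lambda>t. (1 - 1/2) *\<^sub>R h1 t + (1/2) *\<^sub>R h2 t) \<in> D e" if h: "h1 \<in> D e" "h2 \<in> D e" for h1 h2 e
  proof -
    obtain w1 w2 where w: "primitive_on T a w1 h1" "\<forall>t\<in>{0..T}. norm (w1 t - u t) \<le> e"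
        "(LINT t|?M. \<Phi> (h1 t)) \<le> A + e"
      "primitive_on T a w2 h2" "\<forall>t\<in>{0..T}. norm (w2 t - u t) \<le> e"
        "(LINT t|?M. \<Phi> (h2 t)) \<le> A + e"
      using h unfolding D_def by blast
    have "norm ((1 - 1/2) *\<^sub>R w1 t + (1/2) *\<^sub>R w2 t - u t) \<le> e" if "t \<in> {0..T}" for t
    proof -
      have "(1 - 1/2) *\<^sub>R w1 t + (1/2) *\<^sub>R w2 t \<in> cball (u t) e"
        using w(2,5) that
        by (intro convexD[OF convex_cball]) (auto simp: dist_norm norm_minus_commute)
      then show ?thesis by (simp add: dist_norm norm_minus_commute)
    qed
    moreover have "(LINT t|?M. \<Phi> ((1 - 1/2) *\<^sub>R h1 t + (1/2) *\<^sub>R h2 t)) \<le> A + e"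
      using LINT_convex_combination_le[OF w(1) w(4) _ _ \<Phi>, of "1/2"] w(3,6) by simp
    moreover have "primitive_on T a (\<lambda>t. (1 - 1/2) *\<^sub>R w1 t + (1/2) *\<^sub>R w2 t)
        (\<lambda>t. (1 - 1/2) *\<^sub>R h1 t + (1/2) *\<^sub>R h2 t)"
      by (rule primitive_on_convex_combination[OF w(1) w(4)]) auto
    ultimately show ?thesis unfolding D_def by blast
  qed
  have N_nonneg: "0 \<le> N h" for h
    unfolding N_def by simp
  have N_int: "integrable ?M (\<lambda>t. (norm (h t))\<^sup>2)" if "h \<in> D e" for h e
    using D_prim[OF that] integrable_norm_square_primitive_on by blast
  have N_le: "N h \<le> T * a\<^sup>2" if h: "h \<in> D e" for h e
  proof -
    obtain w where w: "primitive_on T a w h" using D_prim[OF h] by blast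
    have "N h \<le> (LINT t|?M. a\<^sup>2)"
      unfolding N_def
    proof (rule integral_mono[OF N_int[OF h]])
      show "integrable ?M (\<lambda>t. a\<^sup>2)"
        by (rule finite_measure.integrable_const[OF finite_measure_lebesgue_on]) simp
    qed (use primitive_on_bound[OF w] in \<open>auto intro: power_mono\<close>)
    also have "\<dots> = T * a\<^sup>2" using T by (intro LINT_const_interval) simp
    finally show ?thesis .
  qed
  have bdd: "bdd_below (N ` X)" for X
    by (rule bdd_belowI2[of _ 0]) (rule N_nonneg)
  have m_le: "m k \<le> N h" if "h \<in> D (\<epsilon> k)" for k h
    unfolding m_def by (rule cINF_lower[OF bdd that])
  have "\<exists>h. h \<in> D (\<epsilon> k) \<and> N h < m k + \<epsilon> k" for k
    using cINF_less_iff[OF D_ne[OF \<epsilon>] bdd, of k "m k + \<epsilon> k"] \<epsilon>[of k] unfolding m_def by auto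
  then obtain h where h: "\<And>k. h k \<in> D (\<epsilon> k)" "\<And>k. N (h k) < m k + \<epsilon> k"
    by metis
  then have h_prim: "\<exists>w. primitive_on T a w (h k)" for k
    using D_prim by blast
  have h_meas: "h k \<in> borel_measurable ?M" and h_bound: "t \<in> {0..T} \<Longrightarrow> norm (h k t) \<le> a" for k t
    using h_prim[of k] primitive_on_measurable primitive_on_bound by blast+
  have m_mono: "incseq m"
  proof (rule incseq_SucI)
    fix k show "m k \<le> m (Suc k)"
      unfolding m_def by (rule cINF_superset_mono[OF D_ne[OF \<epsilon>] bdd D_mono[OF \<epsilon>_anti]]) auto
  qed
  have "m k \<le> T * a\<^sup>2" for k
    using m_le[OF h(1)] N_le[OF h(1)] by (rule order_trans)
  then obtain \<mu> where \<mu>: "m \<longlonglongrightarrow> \<mu>" "\<And>k. m k \<le> \<mu>"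
    using incseq_convergent[OF m_mono] by metis
  \<comment> \<open>For \<open>k \<le> l\<close> the slopes \<open>h k\<close>, \<open>h l\<close>
    and their midpoint lie in \<open>D (\<epsilon> k)\<close>, so the parallelogram identity bounds
    the squared distance by \<open>2 * (m k + \<epsilon> k) + 2 * (\<mu> + \<epsilon> k) - 4 * m
    k\<close>, which is this quantity.\<close>
  define \<rho> where "\<rho> k = 2 * (\<mu> - m k) + 4 * \<epsilon> k" for k
  have \<rho>_lim: "\<rho> \<longlonglongrightarrow> 0"
    unfolding \<rho>_def by (rule tendsto_eq_intros \<mu> \<epsilon>_lim refl | simp)+
  have para: "(LINT t|?M. (norm (h k t - h l t))\<^sup>2) \<le> \<rho> k" if kl: "k \<le> l" for k l
  proof -
    have hl: "h l \<in> D (\<epsilon> k)" using h(1)[of l] D_mono[OF \<epsilon>_anti[OF kl]] by blast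
    let ?mid = "\<lambda>t. (1 - 1/2) *\<^sub>R h k t + (1/2) *\<^sub>R h l t"
    have mid: "?mid \<in> D (\<epsilon> k)" by (rule D_mid[OF h(1) hl])
    have "(LINT t|?M. (norm (h k t - h l t))\<^sup>2)
        = (LINT t|?M. 2 * (norm (h k t))\<^sup>2 + 2 * (norm (h l t))\<^sup>2 - 4 * (norm (?mid t))\<^sup>2)"
    proof (rule Bochner_Integration.integral_cong[OF refl])
      fix t
      have "?mid t = (1/2) *\<^sub>R (h k t + h l t)" by (simp add: scaleR_add_right)
      then have "4 * (norm (?mid t))\<^sup>2 = (norm (h k t + h l t))\<^sup>2"
        by (simp add: power_mult_distrib power2_eq_square)
      then show "(norm (h k t - h l t))\<^sup>2 = 2 * (norm (h k t))\<^sup>2 + 2 * (norm (h l t))\<^sup>2 - 4 * (norm (?mid t))\<^sup>2"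
        by (simp add: power2_norm_eq_inner inner_add_left inner_add_right inner_diff_left inner_diff_right inner_commute)
    qed
    also have "\<dots> = 2 * N (h k) + 2 * N (h l) - 4 * N ?mid"
      unfolding N_def using N_int[OF h(1)[of k]] N_int[OF h(1)[of l]] N_int[OF mid] by simp
    also have "\<dots> \<le> 2 * (m k + \<epsilon> k) + 2 * (\<mu> + \<epsilon> k) - 4 * m k"
    proof -
      have "N (h k) \<le> m k + \<epsilon> k" "N (h l) \<le> \<mu> + \<epsilon> k"
        using h(2)[of k] h(2)[of l] \<mu>(2)[of l] \<epsilon>_anti[OF kl] by linarith+
      then show ?thesis
        using m_le[OF mid] by (intro diff_mono add_mono mult_left_mono) simp_all
    qed
    finally show ?thesis by (simp add: \<rho>_def)
  qed
  have para': "(LINT t|?M. (norm (h k t - h l t))\<^sup>2) \<le> max (\<rho> k) (\<rho> l)" for k l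
    using para[of k l] para[of l k] by (cases "k \<le> l") (auto simp: norm_minus_commute)
  have diff_int: "integrable ?M (\<lambda>t. (norm (h k t - h l t))\<^sup>2)" "integrable ?M (\<lambda>t. norm (h k t - h l t))" for k l
  proof -
    have meas: "(\<lambda>t. h k t - h l t) \<in> borel_measurable ?M"
      using h_meas by measurable
    have b: "norm (h k t - h l t) \<le> a + a" if "t \<in> {0..T}" for t
      by (rule order_trans[OF norm_triangle_ineq4 add_mono]) (use h_bound that in auto)
    show "integrable ?M (\<lambda>t. norm (h k t - h l t))"
      using integrable_bounded_interval[OF meas b] by (rule integrable_norm)
    show "integrable ?M (\<lambda>t. (norm (h k t - h l t))\<^sup>2)"
    proof (rule integrable_bounded_interval)
      show "(\<lambda>t. (norm (h k t - h l t))\<^sup>2) \<in> borel_measurable ?M"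
        using meas by measurable
      show "norm ((norm (h k t - h l t))\<^sup>2) \<le> (a + a)\<^sup>2" if "t \<in> {0..T}" for t
        using power_mono[OF b[OF that] norm_ge_zero, of 2] by simp
    qed
  qed
  have L1: "\<exists>K. \<forall>k\<ge>K. \<forall>l\<ge>K. (LINT t|?M. norm (h k t - h l t)) < e" if e: "0 < e" for e
  proof -
    \<comment> \<open>Passage from squares to first powers by
      \<open>x \<le> d + x\<^sup>2 / d\<close>: the first term integrates to
      \<open>T * d = e / 2\<close>, and the second is below \<open>e / 2\<close> once the integral
      of the square is below \<open>d * e / 2\<close>.\<close>
    define d where "d = e / (2 * T)"
    have d: "0 < d" "T * d = e / 2" using e T by (auto simp: d_def)
    have "\<forall>\<^sub>F k in sequentially. \<rho> k < d * e / 2"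
      using \<rho>_lim d e by (intro order_tendstoD) auto
    then obtain K where K: "\<And>k. k \<ge> K \<Longrightarrow> \<rho> k < d * e / 2"
      unfolding eventually_sequentially by blast
    have "(LINT t|?M. norm (h k t - h l t)) < e" if kl: "k \<ge> K" "l \<ge> K" for k l
    proof -
      have ci: "integrable ?M (\<lambda>t. d)"
        by (rule finite_measure.integrable_const[OF finite_measure_lebesgue_on]) simp
      have "(LINT t|?M. norm (h k t - h l t)) \<le> (LINT t|?M. d + (norm (h k t - h l t))\<^sup>2 / d)"
      proof (rule integral_mono[OF diff_int(2)])
        show "integrable ?M (\<lambda>t. d + (norm (h k t - h l t))\<^sup>2 / d)"
          using diff_int(1)[of k l] ci by simp
        fix t
        have "x \<le> d + x\<^sup>2 / d" if "0 \<le> x" for x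
        proof (cases "x \<le> d")
          case False
          then have "x * d \<le> x\<^sup>2"
            using that by (simp add: power2_eq_square mult_left_mono)
          then have "x \<le> x\<^sup>2 / d" using d by (simp add: pos_le_divide_eq)
          then show ?thesis using d by linarith
        qed (use d in \<open>simp add: add_increasing2\<close>)
        then show "norm (h k t - h l t) \<le> d + (norm (h k t - h l t))\<^sup>2 / d" by simp
      qed
      also have "\<dots> = T * d + (LINT t|?M. (norm (h k t - h l t))\<^sup>2) / d"
        using diff_int(1)[of k l] ci T by (simp add: LINT_const_interval del: lebesgue_integral_const)
      also have "\<dots> < e / 2 + e / 2"
      proof -
        have "(LINT t|?M. (norm (h k t - h l t))\<^sup>2) < d * e / 2"
          using para'[of k l] K[OF kl(1)] K[OF kl(2)] by simp
        then have "(LINT t|?M. (norm (h k t - h l t))\<^sup>2) / d < e / 2"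
          using d(1) by (simp add: pos_divide_less_eq mult.commute)
        then show ?thesis using d(2) by linarith
      qed
      finally show ?thesis by simp
    qed
    then show ?thesis by blast
  qed
  have h_int: "integrable ?M (h k)" for k
    by (rule integrable_bounded_interval[OF h_meas h_bound])
  obtain r where r: "strict_mono r" "AE t in ?M. Cauchy (\<lambda>i. h (r i) t)"
    using cauchy_L1_AE_cauchy_subseq[OF h_int L1] by blast
  define H0 where "H0 t = lim (\<lambda>i. h (r i) t)" for t
  have H0_lim: "AE t in ?M. (\<lambda>i. h (r i) t) \<longlonglongrightarrow> H0 t"
    using r(2) by eventually_elim (simp add: H0_def Cauchy_convergent convergent_LIMSEQ_iff[symmetric])
  have H0_meas[measurable]: "H0 \<in> borel_measurable ?M"
    unfolding H0_def using h_meas by (intro borel_measurable_lim_metric) auto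
  \<comment> \<open>\<open>H0\<close> is the limit only almost everywhere; truncation enforces the
    bound at the remaining points too.\<close>
  define H where "H t = (if norm (H0 t) \<le> a then H0 t else 0)" for t
  have H_meas: "H \<in> borel_measurable ?M" unfolding H_def by measurable
  have H_bound: "norm (H t) \<le> a" for t using a by (simp add: H_def)
  have H_lim: "AE t in ?M. (\<lambda>i. h (r i) t) \<longlonglongrightarrow> H t"
    using H0_lim AE_space
  proof eventually_elim
    case (elim t)
    then have "norm (H0 t) \<le> a"
      by (intro LIMSEQ_le_const2[OF tendsto_norm]) (use h_bound in auto)
    then show ?case using elim by (simp add: H_def)
  qed
  have H_int: "integrable ?M H"
    by (rule integrable_bounded_interval[OF H_meas H_bound])
  have \<epsilon>r: "(\<lambda>i. \<epsilon> (r i)) \<longlonglongrightarrow> 0"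
    using LIMSEQ_subseq_LIMSEQ[OF \<epsilon>_lim r(1)] by (simp add: comp_def)
  \<comment> \<open>The functions with slopes \<open>h k\<close>. They tend to \<open>u\<close>, so
    the relation between function and slope passes to the limit and makes \<open>H\<close> a slope
    of \<open>u\<close>.\<close>
  obtain w where w: "\<And>k. primitive_on T a (w k) (h k)"
      "\<And>k t. t \<in> {0..T} \<Longrightarrow> norm (w k t - u t) \<le> \<epsilon> k"
      "\<And>k. (LINT t|?M. \<Phi> (h k t)) \<le> A + \<epsilon> k"
    using h(1) unfolding D_def mem_Collect_eq by metis
  have w_lim: "(\<lambda>i. w (r i) t) \<longlonglongrightarrow> u t" if t: "t \<in> {0..T}" for t
  proof (rule LIM_zero_cancel, rule Lim_null_comparison[OF _ \<epsilon>r])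
    show "\<forall>\<^sub>F i in sequentially. norm (w (r i) t - u t) \<le> \<epsilon> (r i)"
      using w(2)[OF t] by simp
  qed
  have ai: "integrable ?M (\<lambda>t. a)"
    by (rule finite_measure.integrable_const[OF finite_measure_lebesgue_on]) simp
  have "primitive_on T a u H"
  proof (rule primitive_onI[OF H_meas H_bound])
    fix t assume t: "t \<in> {0..T}"
    have "(\<lambda>i. LINT s|?M. indicator {..t} s *\<^sub>R h (r i) s) \<longlonglongrightarrow> (LINT s|?M. indicator {..t} s *\<^sub>R H s)"
    proof (rule integral_dominated_convergence[OF _ _ ai])
      show "(\<lambda>s. indicator {..t} s *\<^sub>R H s) \<in> borel_measurable ?M"
        "\<And>i. (\<lambda>s. indicator {..t} s *\<^sub>R h (r i) s) \<in> borel_measurable ?M"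
        using integrable_indicator_lebesgue_on[OF H_int, of "{..t}"]
          integrable_indicator_lebesgue_on[OF h_int, of "{..t}"] by auto
      show "AE s in ?M. (\<lambda>i. indicator {..t} s *\<^sub>R h (r i) s) \<longlonglongrightarrow> indicator {..t} s *\<^sub>R H s"
        using H_lim by eventually_elim (intro tendsto_intros)
      show "AE s in ?M. norm (indicator {..t} s *\<^sub>R h (r i) s) \<le> a" for i
        using h_bound a by (auto simp: indicator_def)
    qed
    then have "(\<lambda>i. integral {0..t} (h (r i))) \<longlonglongrightarrow> integral {0..t} H"
      unfolding integral_upto_eq_LINT[OF h_int t] integral_upto_eq_LINT[OF H_int t] .
    moreover have "0 \<in> {0..T}" using T by simp
    ultimately have "(\<lambda>i. w (r i) 0 + integral {0..t} (h (r i))) \<longlonglongrightarrow> u 0 + integral {0..t} H"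
      by (intro tendsto_add w_lim)
    then have "(\<lambda>i. w (r i) t) \<longlonglongrightarrow> u 0 + integral {0..t} H"
      unfolding primitive_on_eq[OF w(1) t, symmetric] .
    with w_lim[OF t] show "u t = u 0 + integral {0..t} H"
      by (rule LIMSEQ_unique)
  qed
  moreover have "(LINT t|?M. \<Phi> (H t)) \<le> A"
  proof (rule LIMSEQ_le)
    have "bounded (\<Phi> ` cball 0 a)"
      by (intro compact_imp_bounded compact_continuous_image \<Phi>) simp
    then obtain B where B: "\<And>x. x \<in> cball 0 a \<Longrightarrow> norm (\<Phi> x) \<le> B"
      unfolding bounded_iff by blast
    show "(\<lambda>i. LINT t|?M. \<Phi> (h (r i) t)) \<longlonglongrightarrow> (LINT t|?M. \<Phi> (H t))"
    proof (rule integral_dominated_convergence[where w = "\<lambda>_. B"])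
      show "(\<lambda>t. \<Phi> (H t)) \<in> borel_measurable ?M" "\<And>i. (\<lambda>t. \<Phi> (h (r i) t)) \<in> borel_measurable ?M"
        using H_meas H_bound h_meas h_bound
        by (auto intro!: borel_measurable_continuous_on_compose[OF \<Phi>(1)])
      show "integrable ?M (\<lambda>t. B)"
        by (rule finite_measure.integrable_const[OF finite_measure_lebesgue_on]) simp
      show "AE t in ?M. (\<lambda>i. \<Phi> (h (r i) t)) \<longlonglongrightarrow> \<Phi> (H t)"
        using H_lim AE_space
        by eventually_elim
          (use H_bound h_bound in \<open>auto intro!: continuous_on_tendsto_compose[OF \<Phi>(1)]\<close>)
      show "AE t in ?M. norm (\<Phi> (h (r i) t)) \<le> B" for i
        using h_bound by (intro AE_I2 B) auto
    qed
    show "(\<lambda>i. A + \<epsilon> (r i)) \<longlonglongrightarrow> A"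
      using tendsto_add[OF tendsto_const \<epsilon>r, of A] by simp
    show "\<exists>n. \<forall>i\<ge>n. (LINT t|?M. \<Phi> (h (r i) t)) \<le> A + \<epsilon> (r i)"
      using w(3) by blast
  qed
  ultimately show thesis by (rule that)
qed

section \<open>Potentials with a singular gradient\<close>

text \<open>The gradient is singular because the inverse \<open>\<psi>\<close> maps each closed ball
  to a compact part of the open ball: near the sphere \<open>norm (\<phi> x)\<close> exceeds every
  bound.\<close>

locale singular_potential =
  fixes a :: real and \<phi> \<psi> :: "'a::euclidean_space \<Rightarrow> 'a" and \<Phi> :: "'a \<Rightarrow> real"
  assumes a_pos: "0 < a" and homeo: "homeomorphism (ball 0 a) UNIV \<phi> \<psi>"
    and grad: "\<And>x. x \<in> ball 0 a \<Longrightarrow> GDERIV \<Phi> x :> \<phi> x"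
    and nonpos: "\<And>x. x \<in> cball 0 a \<Longrightarrow> \<Phi> x \<le> 0"
    and cont: "continuous_on (cball 0 a) \<Phi>"
    and strict: "strictly_convex_on (cball 0 a) \<Phi>"
begin

section \<open>Gradient inequalities and steepness at the sphere\<close>

lemma convex_Phi: "convex_on (cball 0 a) \<Phi>"
proof (rule convex_onI)
  fix t :: real and x y :: 'a assume "0 < t" "t < 1" "x \<in> cball 0 a" "y \<in> cball 0 a"
  then show "\<Phi> ((1 - t) *\<^sub>R x + t *\<^sub>R y) \<le> (1 - t) * \<Phi> x + t * \<Phi> y"
    using strict by (cases "x = y") (auto simp: strictly_convex_on_def less_imp_le algebra_simps)
qed simp

lemma psi_ball: "norm (\<psi> y) < a"
  and phi_psi: "\<phi> (\<psi> y) = y"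
  and psi_phi: "norm x < a \<Longrightarrow> \<psi> (\<phi> x) = x"
  and psi_cont: "continuous_on UNIV \<psi>"
  using homeo by (auto simp: homeomorphism_def)

text \<open>Convexity along the segment from \<open>y\<close> to \<open>x\<close>, divided by the
  parameter. The base point lies in the open ball, where the gradient exists; the test point may lie
  on the sphere.\<close>

lemma gradient_inequality:
  assumes y: "norm y < a" and x: "norm x \<le> a"
  shows "\<Phi> y + \<phi> y \<bullet> (x - y) \<le> \<Phi> x"
proof -
  let ?f = "\<lambda>s. \<Phi> (y + s *\<^sub>R (x - y))"
  have "(\<Phi> has_derivative (\<lambda>h. h \<bullet> \<phi> y)) (at (y + 0 *\<^sub>R (x - y)))"
    using grad[of y] y by (simp add: gderiv_def)
  moreover have "((\<lambda>s. y + s *\<^sub>R (x - y)) has_derivative (\<lambda>s. s *\<^sub>R (x - y))) (at 0)"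
    by (auto intro!: derivative_eq_intros)
  ultimately have "(?f has_derivative (\<lambda>s. (s *\<^sub>R (x - y)) \<bullet> \<phi> y)) (at 0)"
    by (rule has_derivative_compose[rotated])
  then have "(?f has_real_derivative (\<phi> y \<bullet> (x - y))) (at 0)"
    by (simp add: has_field_derivative_def inner_commute mult.commute[of _ "_ \<bullet> _"])
  then have "((\<lambda>h. (?f h - ?f 0) / h) \<longlongrightarrow> \<phi> y \<bullet> (x - y)) (at 0)"
    by (simp add: DERIV_def)
  then have lim: "((\<lambda>h. (?f h - ?f 0) / h) \<longlongrightarrow> \<phi> y \<bullet> (x - y)) (at_right 0)"
    by (rule filterlim_mono) (auto simp: at_le)
  have "\<forall>\<^sub>F h::real in at_right 0. h < 1"
    by (rule order_tendstoD(2)[of _ 0]) (auto intro: tendsto_intros)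
  then have "\<forall>\<^sub>F h in at_right 0. (?f h - ?f 0) / h \<le> \<Phi> x - \<Phi> y"
    using eventually_at_right_less[of 0]
  proof eventually_elim
    case (elim h)
    have "y + h *\<^sub>R (x - y) = (1 - h) *\<^sub>R y + h *\<^sub>R x"
      by (simp add: algebra_simps)
    then have "?f h \<le> (1 - h) * \<Phi> y + h * \<Phi> x"
      using convex_onD[OF convex_Phi, of h y x] elim x y by simp
    then have "?f h - ?f 0 \<le> (\<Phi> x - \<Phi> y) * h"
      by (simp add: algebra_simps)
    then show ?case using elim by (simp add: pos_divide_le_eq)
  qed
  with lim have "\<phi> y \<bullet> (x - y) \<le> \<Phi> x - \<Phi> y"
    by (intro tendsto_upperbound[OF lim]) auto
  then show ?thesis by simp
qed

text \<open>Strictness comes from the midpoint: the weak inequality there and strict convexity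
  combine to the strict one at \<open>x\<close>.\<close>

lemma gradient_inequality_strict:
  assumes y: "norm y < a" and x: "norm x \<le> a" and "x \<noteq> y"
  shows "\<Phi> y + \<phi> y \<bullet> (x - y) < \<Phi> x"
proof -
  let ?m = "(1 - 1/2) *\<^sub>R y + (1/2) *\<^sub>R x"
  have "?m \<in> cball 0 a"
    using x y by (intro convexD[OF convex_cball]) auto
  then have "\<Phi> y + \<phi> y \<bullet> (?m - y) \<le> \<Phi> ?m"
    using y by (intro gradient_inequality) auto
  moreover have "\<Phi> ?m < (1 - 1/2) * \<Phi> y + (1/2) * \<Phi> x"
    using strict[unfolded strictly_convex_on_def, THEN conjunct2, rule_format, of y x "1/2"]
      x y \<open>x \<noteq> y\<close> by auto
  moreover have "?m - y = (1/2) *\<^sub>R (x - y)"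
    by (simp only: scaleR_diff_left scaleR_diff_right scaleR_one) (simp add: algebra_simps)
  ultimately show ?thesis by simp
qed

text \<open>Converts a large gradient into a large radial slope. The gradient inequality at
  \<open>y\<close> is tested with the vector of length \<open>a / 2\<close> in the direction of
  \<open>\<phi> y\<close>; \<open>M\<close> bounds \<open>\<Phi>\<close> on the closed ball.\<close>

lemma phi_inner_lower_bound:
  obtains M where "0 \<le> M" "\<And>y. norm y < a \<Longrightarrow> a / 2 * norm (\<phi> y) - M \<le> \<phi> y \<bullet> y"
proof -
  have "bounded (\<Phi> ` cball 0 a)"
    by (intro compact_imp_bounded compact_continuous_image cont) simp
  then obtain M where M: "\<And>x. x \<in> cball 0 a \<Longrightarrow> norm (\<Phi> x) \<le> M"
    unfolding bounded_iff by blast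
  have "0 \<le> M" using M[of 0] a_pos by (auto intro: order_trans[OF norm_ge_zero])
  moreover have "a / 2 * norm (\<phi> y) - M \<le> \<phi> y \<bullet> y" if y: "norm y < a" for y
  proof (cases "\<phi> y = 0")
    case True
    then show ?thesis using \<open>0 \<le> M\<close> by simp
  next
    case False
    define z where "z = (a / 2 / norm (\<phi> y)) *\<^sub>R \<phi> y"
    have z: "norm z \<le> a" using False a_pos by (simp add: z_def)
    have "\<phi> y \<bullet> z = a / 2 * norm (\<phi> y)"
      using False by (simp add: z_def power2_norm_eq_inner[symmetric] power2_eq_square)
    then show ?thesis
      using gradient_inequality[OF y z] nonpos[of z] M[of y] z y by (simp add: inner_diff_right)
  qed
  ultimately show thesis by (rule that)
qed

text \<open>On an inner sphere close enough to the boundary the radial slope is already at least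
  \<open>R\<close>, and by convexity it bounds the slope further out from below. That
  \<open>s\<close> is the same for all directions is what later allows integration over
  \<open>t\<close>.\<close>

lemma steep_at_boundary:
  obtains s where "0 < s" "s < 1" "\<And>x. norm x = a \<Longrightarrow> s * R \<le> \<Phi> x - \<Phi> ((1 - s) *\<^sub>R x)"
proof -
  obtain M where M: "0 \<le> M" "\<And>y. norm y < a \<Longrightarrow> a / 2 * norm (\<phi> y) - M \<le> \<phi> y \<bullet> y"
    using phi_inner_lower_bound by blast
  \<comment> \<open>Solves \<open>a / 2 * Q - M = max R 0\<close>. The maximum makes the radial
    slope nonnegative, so that replacing \<open>?y\<close> by the longer vector \<open>x\<close> can
    only increase it.\<close>
  define Q where "Q = 2 / a * (max R 0 + M)"
  have "compact (norm ` \<psi> ` cball 0 Q)"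
    by (intro compact_continuous_image continuous_on_norm_id continuous_on_subset[OF psi_cont]) auto
  moreover have "0 \<le> Q" using M(1) a_pos by (simp add: Q_def)
  then have "norm ` \<psi> ` cball 0 Q \<noteq> {}" by simp
  ultimately obtain r where r: "r \<in> norm ` \<psi> ` cball 0 Q" "\<And>r'. r' \<in> norm ` \<psi> ` cball 0 Q \<Longrightarrow> r' \<le> r"
    using compact_attains_sup[of "norm ` \<psi> ` cball 0 Q"] by blast
  have r': "0 \<le> r" "r < a" using r(1) psi_ball by auto
  \<comment> \<open>Puts \<open>(1 - s) *\<^sub>R x\<close> at radius \<open>(a + r) / 2\<close>,
    midway between \<open>r\<close> and \<open>a\<close>; beyond \<open>r\<close> the gradient has
    norm above \<open>Q\<close>.\<close>
  define s where "s = (a - r) / (2 * a)"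
  have s: "0 < s" "s < 1" using r' a_pos by (auto simp: s_def field_simps)
  have "s * R \<le> \<Phi> x - \<Phi> ((1 - s) *\<^sub>R x)" if x: "norm x = a" for x
  proof -
    let ?y = "(1 - s) *\<^sub>R x"
    have ny: "norm ?y = (a + r) / 2"
      using s x a_pos by (simp add: s_def field_simps)
    then have y: "norm ?y < a" "r < norm ?y" using r' by auto
    have "Q < norm (\<phi> ?y)"
    proof (rule ccontr)
      assume "\<not> Q < norm (\<phi> ?y)"
      then have "norm (\<psi> (\<phi> ?y)) \<in> norm ` \<psi> ` cball 0 Q" by (intro imageI) simp
      then show False using r(2) psi_phi[OF y(1)] y(2) by fastforce
    qed
    then have "max R 0 + M \<le> a / 2 * norm (\<phi> ?y)"
      using a_pos by (simp add: Q_def field_simps)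
    then have R: "max R 0 \<le> \<phi> ?y \<bullet> ?y"
      using M(2)[OF y(1)] by linarith
    then have "0 \<le> (1 - s) * (\<phi> ?y \<bullet> x)" by simp
    then have "0 \<le> \<phi> ?y \<bullet> x" using s by (simp add: zero_le_mult_iff)
    then have "(1 - s) * (\<phi> ?y \<bullet> x) \<le> \<phi> ?y \<bullet> x"
      using s by (intro mult_left_le_one_le) auto
    then have "R \<le> \<phi> ?y \<bullet> x" using R by simp
    then have "s * R \<le> s * (\<phi> ?y \<bullet> x)" using s by simp
    moreover have "x - ?y = s *\<^sub>R x" by (simp add: algebra_simps)
    ultimately show ?thesis
      using gradient_inequality[OF y(1), of x] x by simp
  qed
  with s show thesis by (rule that)
qed

text \<open>The Legendre transform of \<open>\<Phi>\<close>; the supremum of \<open>x \<bullet> y - \<Phi> x\<close> is attained at \<open>\<psi> y\<close>.\<close>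

definition conj_Phi :: "'a \<Rightarrow> real" where
  "conj_Phi y = \<psi> y \<bullet> y - \<Phi> (\<psi> y)"

lemma conj_Phi_ge: "norm x \<le> a \<Longrightarrow> x \<bullet> y - \<Phi> x \<le> conj_Phi y"
  using gradient_inequality[OF psi_ball, of x y]
  by (simp add: conj_Phi_def phi_psi inner_diff_right inner_commute)

text \<open>The Fenchel-Young inequality at the point \<open>\<psi> y\<close>. With this subgradient
  the dual functional is handled without differentiating \<open>conj_Phi\<close>.\<close>

lemma conj_Phi_subgradient: "conj_Phi y + \<psi> y \<bullet> (y' - y) \<le> conj_Phi y'"
  using conj_Phi_ge[of "\<psi> y" y'] psi_ball[of y] by (simp add: conj_Phi_def inner_diff_right)

text \<open>Fenchel-Young tested on the sphere in the direction of \<open>y\<close>; the sign of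
  \<open>\<Phi>\<close> there leaves no additive constant.\<close>

lemma conj_Phi_coercive: "a * norm y \<le> conj_Phi y"
proof (cases "y = 0")
  case True
  then show ?thesis using nonpos[of "\<psi> y"] psi_ball[of y] by (simp add: conj_Phi_def)
next
  case False
  define x where "x = (a / norm y) *\<^sub>R y"
  have "norm x \<le> a" "x \<bullet> y = a * norm y"
    using False a_pos by (auto simp: x_def power2_norm_eq_inner[symmetric] power2_eq_square)
  then show ?thesis using conj_Phi_ge[of x y] nonpos[of x] by simp
qed

lemma continuous_conj_Phi: "continuous_on UNIV conj_Phi"
  unfolding conj_Phi_def
  by (intro continuous_intros psi_cont continuous_on_compose2[OF cont psi_cont])
    (use psi_ball in \<open>auto simp: less_imp_le\<close>)

text \<open>
  \<open>c\<close> minimises the dual functional \<open>c \<mapsto> \<integral> \<Phi>\<^sup>*(c - P) - c \<bullet> q\<close>, which is coercive because \<open>norm q < a T\<close>.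
\<close>

lemma ex_integral_psi_eq:
  fixes P :: "real \<Rightarrow> 'a"
  assumes T: "0 < T" and P: "continuous_on {0..T} P" and q: "norm q < a * T"
  obtains c where "integral {0..T} (\<lambda>t. \<psi> (c - P t)) = q"
proof -
  define H where "H c = integral {0..T} (\<lambda>t. conj_Phi (c - P t)) - c \<bullet> q" for c
  define K where "K c = integral {0..T} (\<lambda>t. \<psi> (c - P t))" for c
  have cd: "continuous_on (UNIV \<times> cbox 0 T) (\<lambda>p. fst p - P (snd p))"
    by (intro continuous_intros continuous_on_compose2[OF P]) auto
  have cK: "continuous_on UNIV K"
    unfolding K_def using continuous_on_compose2[OF psi_cont cd]
    by (intro integral_continuous_on_param[of UNIV 0 T, unfolded cbox_interval]) (auto simp: case_prod_beta)
  have cH: "continuous_on UNIV H"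
    unfolding H_def using continuous_on_compose2[OF continuous_conj_Phi cd]
    by (intro continuous_intros integral_continuous_on_param[of UNIV 0 T, unfolded cbox_interval])
      (auto simp: case_prod_beta)
  have int_conj: "(\<lambda>t. conj_Phi (c - P t)) integrable_on {0..T}" for c
    by (intro integrable_continuous_interval continuous_on_compose2[OF continuous_conj_Phi] continuous_intros P) auto
  have int_psi: "(\<lambda>t. \<psi> (c - P t)) integrable_on {0..T}" for c
    by (intro integrable_continuous_interval continuous_on_compose2[OF psi_cont] continuous_intros P) auto
  obtain B where B: "\<And>t. t \<in> {0..T} \<Longrightarrow> norm (P t) \<le> B"
    using continuous_interval_measurable_bounded(2)[OF P] by blast
  have coercive: "(a * T - norm q) * norm c - a * T * B \<le> H c" for c
  proof -
    have "integral {0..T} (\<lambda>t. a * (norm c - B)) \<le> integral {0..T} (\<lambda>t. conj_Phi (c - P t))"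
    proof (rule integral_le[OF _ int_conj])
      fix t assume t: "t \<in> {0..T}"
      have "norm c - B \<le> norm (c - P t)"
        using B[OF t] norm_triangle_ineq2[of c "P t"] by linarith
      then have "a * (norm c - B) \<le> a * norm (c - P t)" using a_pos by simp
      also have "\<dots> \<le> conj_Phi (c - P t)" by (rule conj_Phi_coercive)
      finally show "a * (norm c - B) \<le> conj_Phi (c - P t)" .
    qed auto
    moreover have "c \<bullet> q \<le> norm c * norm q" by (rule norm_cauchy_schwarz)
    ultimately show ?thesis
      using T by (simp add: H_def algebra_simps)
  qed
  \<comment> \<open>Outside this radius the coercive lower bound is at least \<open>H 0\<close>, so
    a minimiser on the ball is global.\<close>
  define R where "R = max 0 ((H 0 + a * T * B) / (a * T - norm q))"
  have "\<exists>c\<in>cball 0 R. \<forall>c'\<in>cball 0 R. H c \<le> H c'"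
    by (rule continuous_attains_inf) (auto simp: R_def intro: continuous_on_subset[OF cH])
  then obtain c where c: "c \<in> cball 0 R" "\<And>c'. c' \<in> cball 0 R \<Longrightarrow> H c \<le> H c'" by blast
  have min: "H c \<le> H c'" for c'
  proof (cases "c' \<in> cball 0 R")
    case False
    then have "(H 0 + a * T * B) / (a * T - norm q) \<le> norm c'"
      by (simp add: R_def)
    then have "H 0 + a * T * B \<le> (a * T - norm q) * norm c'"
      using q by (simp add: pos_divide_le_eq mult.commute)
    then have "H 0 \<le> H c'" using coercive[of c'] by linarith
    moreover have "H c \<le> H 0" by (rule c) (simp add: R_def)
    ultimately show ?thesis by linarith
  qed (rule c)
  have pos: "0 \<le> (K c - q) \<bullet> z" for z
  proof -
    \<comment> \<open>Minimality at \<open>c\<close> is confronted with the subgradient at the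
      displaced point \<open>c + s *\<^sub>R z\<close>; continuity of \<open>K\<close> then lets
      \<open>s\<close> tend to 0, so \<open>H\<close> is never differentiated.\<close>
    have *: "0 \<le> (K (c + s *\<^sub>R z) - q) \<bullet> z" if s: "0 < s" for s
    proof -
      let ?c = "c + s *\<^sub>R z"
      have i: "(\<lambda>t. \<psi> (?c - P t) \<bullet> (s *\<^sub>R z)) integrable_on {0..T}"
        by (rule integral_inner_left[OF int_psi])
      have "integral {0..T} (\<lambda>t. conj_Phi (?c - P t) - \<psi> (?c - P t) \<bullet> (s *\<^sub>R z))
          \<le> integral {0..T} (\<lambda>t. conj_Phi (c - P t))"
      proof (rule integral_le[OF _ int_conj])
        fix t
        show "conj_Phi (?c - P t) - \<psi> (?c - P t) \<bullet> (s *\<^sub>R z) \<le> conj_Phi (c - P t)"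
          using conj_Phi_subgradient[of "?c - P t" "c - P t"] by simp
      qed (intro Henstock_Kurzweil_Integration.integrable_diff int_conj i)
      then have "integral {0..T} (\<lambda>t. conj_Phi (?c - P t)) - K ?c \<bullet> (s *\<^sub>R z)
          \<le> integral {0..T} (\<lambda>t. conj_Phi (c - P t))"
        unfolding Henstock_Kurzweil_Integration.integral_diff[OF int_conj i] integral_inner_left(1)[OF int_psi] K_def .
      then have "H ?c + s * (z \<bullet> q) - s * (K ?c \<bullet> z) \<le> H c"
        by (simp add: H_def inner_add_left)
      then have "0 \<le> s * ((K ?c - q) \<bullet> z)"
        using min[of ?c] by (simp add: inner_diff_left algebra_simps inner_commute)
      then show ?thesis using s by (simp add: zero_le_mult_iff)
    qed
    have "((\<lambda>s. c + s *\<^sub>R z) \<longlongrightarrow> c + 0 *\<^sub>R z) (at_right 0)"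
      by (intro tendsto_intros)
    then have "((\<lambda>s. K (c + s *\<^sub>R z)) \<longlongrightarrow> K (c + 0 *\<^sub>R z)) (at_right 0)"
      using cK by (auto simp: continuous_on_eq_continuous_at intro: isCont_tendsto_compose)
    then have "((\<lambda>s. (K (c + s *\<^sub>R z) - q) \<bullet> z) \<longlongrightarrow> (K (c + 0 *\<^sub>R z) - q) \<bullet> z) (at_right 0)"
      by (intro tendsto_intros)
    then have "0 \<le> (K (c + 0 *\<^sub>R z) - q) \<bullet> z"
      by (rule tendsto_lowerbound) (auto intro: eventually_mono[OF eventually_at_right_less[of 0]] *)
    then show ?thesis by simp
  qed
  \<comment> \<open>The direction opposite to the residual forces the residual to vanish.\<close>
  have "0 \<le> (K c - q) \<bullet> (- (K c - q))" by (rule pos)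
  then have "(K c - q) \<bullet> (K c - q) \<le> 0" by (simp only: inner_minus_right)
  then have "K c = q" by (metis inner_gt_zero_iff not_le right_minus_eq)
  then show thesis unfolding K_def by (rule that)
qed

end

section \<open>Existence of a minimiser\<close>

lemma lower_semicontinuous_sequentially:
  fixes f :: "'a::first_countable_topology \<Rightarrow> ereal"
  assumes f: "lower_semicontinuous f" and x: "x \<longlonglongrightarrow> z" and b: "b \<longlonglongrightarrow> \<beta>"
    and le: "\<And>n::nat. f (x n) \<le> ereal (b n)"
  shows "f z \<le> ereal \<beta>"
proof (rule ccontr)
  assume "\<not> f z \<le> ereal \<beta>"
  then obtain c where c: "ereal \<beta> < c" "c < f z"
    by (metis dense not_le)
  have "c < Liminf (at z) f"
    using c(2) f unfolding lower_semicontinuous_def by (metis less_le_trans)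
  then have "\<forall>\<^sub>F y in at z. c < f y"
    by (rule less_LiminfD)
  \<comment> \<open>Lower semicontinuity is stated with the punctured filter; \<open>z\<close> is
    added because the sequence may take this value.\<close>
  then have "\<forall>\<^sub>F y in nhds z. c < f y"
    unfolding eventually_at_filter by eventually_elim (use c(2) in \<open>metis UNIV_I\<close>)
  then have "\<forall>\<^sub>F n in sequentially. c < f (x n)"
    using x by (rule eventually_compose_filterlim)
  moreover have "\<forall>\<^sub>F n in sequentially. ereal (b n) < c"
    by (rule order_tendstoD(2)[OF _ c(1)]) (use b in simp)
  ultimately have "\<forall>\<^sub>F n in sequentially. False"
    by eventually_elim (use le in \<open>metis less_le_trans less_asym\<close>)
  then show False by simp
qed

lemma mean_value_eq_integral:
  fixes v :: "real \<Rightarrow> 'a::euclidean_space"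
  assumes "continuous_on {0..T} v"
  shows "mean_value T v = (1 / T) *\<^sub>R integral {0..T} v"
  using LINT_interval_eq_integral[OF continuous_interval_measurable_bounded(3)[OF assms]]
  by (simp add: mean_value_def)

text \<open>A function with Lipschitz constant \<open>a\<close> deviates from its mean by at most
  \<open>a * T\<close>, so a bound on the means is all that compactness of a family of such
  functions still requires.\<close>

lemma norm_primitive_on_le_mean:
  assumes v: "primitive_on T a v g" and t: "t \<in> {0..T}" and T: "0 < T"
  shows "norm (v t) \<le> norm (mean_value T v) + a * T"
proof -
  have a: "0 \<le> a"
    using primitive_on_bound[OF v t] by (auto intro: order_trans[OF norm_ge_zero])
  note cont = primitive_on_continuous[OF v]
  have vi: "v integrable_on {0..T}" by (rule integrable_continuous_interval[OF cont])
  have "norm (integral (cbox 0 T) (\<lambda>s. v t - v s)) \<le> a * T * measure lborel (cbox 0 T)"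
  proof (rule integrable_bound)
    show "(\<lambda>s. v t - v s) integrable_on cbox 0 T"
      using vi by (auto intro!: Henstock_Kurzweil_Integration.integrable_diff)
    fix s assume "s \<in> cbox 0 T"
    then have s: "s \<in> {0..T}" by simp
    have "norm (v t - v s) \<le> a * \<bar>t - s\<bar>"
      by (rule primitive_on_Lipschitz[OF v s t])
    also have "\<dots> \<le> a * T" using s t a by (intro mult_left_mono) auto
    finally show "norm (v t - v s) \<le> a * T" .
  qed (use a T in simp)
  then have "norm (T *\<^sub>R v t - integral {0..T} v) \<le> a * T * T"
    using T Henstock_Kurzweil_Integration.integral_diff[OF integrable_const_ivl vi, of "v t"] by simp
  moreover have "T *\<^sub>R v t - integral {0..T} v = T *\<^sub>R (v t - mean_value T v)"
    using T by (simp add: mean_value_eq_integral[OF cont] scaleR_diff_right)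
  ultimately have "norm (v t - mean_value T v) \<le> a * T"
    using T by simp
  then show ?thesis
    using norm_triangle_ineq2[of "v t" "mean_value T v"] by linarith
qed

text \<open>With \<open>j 0 = 0\<close>, the inclusion of 0 in the subdifferential at 0 says
  precisely that \<open>j\<close> is nonnegative. In this form it also keeps
  \<open>-\<infinity>\<close> out of the sums of extended reals.\<close>

locale bvp = singular_potential a \<phi> \<psi> \<Phi>
  for a :: real and \<phi> \<psi> :: "'a::euclidean_space \<Rightarrow> 'a" and \<Phi> :: "'a \<Rightarrow> real" +
  fixes T :: real and F :: "real \<Rightarrow> 'a \<Rightarrow> real" and gradF :: "real \<Rightarrow> 'a \<Rightarrow> 'a"
    and j :: "'a \<times> 'a \<Rightarrow> ereal"
  assumes T_pos: "0 < T"
    and F_cont: "continuous_on ({0..T} \<times> UNIV) (\<lambda>(t, u). F t u)"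
    and F_grad: "\<And>t u. t \<in> {0..T} \<Longrightarrow> GDERIV (F t) u :> gradF t u"
    and gradF_cont: "continuous_on ({0..T} \<times> UNIV) (\<lambda>(t, u). gradF t u)"
    and j_convex: "convex_fun j" and j_lsc: "lower_semicontinuous j"
    and j_nonneg: "0 \<le> j z" and j_0: "j 0 = 0"
begin

section \<open>The energy in terms of slopes\<close>

definition S :: "(real \<Rightarrow> 'a) \<Rightarrow> real" where
  "S g = (LINT t|lebesgue_on {0..T}. \<Phi> (g t))"

lemma continuous_on_F_compose:
  assumes "continuous_on {0..T} v"
  shows "continuous_on {0..T} (\<lambda>t. F t (v t))"
proof -
  have "continuous_on {0..T} (\<lambda>t. (t, v t))"
    by (intro continuous_intros assms)
  from continuous_on_compose2[OF F_cont this] show ?thesis by auto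
qed

lemma continuous_on_gradF_compose:
  assumes "continuous_on {0..T} v"
  shows "continuous_on {0..T} (\<lambda>t. gradF t (v t))"
proof -
  have "continuous_on {0..T} (\<lambda>t. (t, v t))"
    by (intro continuous_intros assms)
  from continuous_on_compose2[OF gradF_cont this] show ?thesis by auto
qed

lemma F_fun_eq:
  assumes "continuous_on {0..T} v"
  shows "F_fun T F v = - integral {0..T} (\<lambda>t. F t (v t))"
  unfolding F_fun_def
  by (subst LINT_interval_eq_integral[OF continuous_interval_measurable_bounded(3)[OF
          continuous_on_F_compose[OF assms]]]) simp

lemma energy_primitive_on:
  assumes "primitive_on T a v g"
  shows "energy T a \<Phi> F j v = ereal (S g - T * \<Phi> 0 + F_fun T F v) + j (v 0, v T)"
  unfolding energy_def J_fun_def Psi_fun_primitive_on[OF assms T_pos cont] S_def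
  using j_nonneg[of "(v 0, v T)"] by (cases "j (v 0, v T)") auto

lemma dom_PsiJ_imp_primitive_on:
  assumes "v \<in> dom_PsiJ T a j"
  obtains g b where "primitive_on T a v g" "j (v 0, v T) = ereal b" "0 \<le> b"
proof -
  obtain g where "primitive_on T a v g"
    using assms K_set_imp_primitive_on[OF _ T_pos less_imp_le[OF a_pos]]
    unfolding dom_PsiJ_def by blast
  moreover obtain b where "j (v 0, v T) = ereal b" "0 \<le> b"
    using assms j_nonneg[of "(v 0, v T)"] by (cases "j (v 0, v T)") (auto simp: dom_PsiJ_def)
  ultimately show thesis by (rule that)
qed

lemma primitive_on_imp_dom_PsiJ:
  "primitive_on T a v g \<Longrightarrow> j (v 0, v T) < \<infinity> \<Longrightarrow> v \<in> dom_PsiJ T a j"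
  using primitive_on_imp_K_set(1)[OF _ T_pos] by (auto simp: dom_PsiJ_def)

lemma F_bounded:
  obtains B where "\<And>t x. t \<in> {0..T} \<Longrightarrow> norm x \<le> R \<Longrightarrow> norm (F t x) \<le> B"
proof -
  have "bounded ((\<lambda>(t, u). F t u) ` ({0..T} \<times> cball 0 R))"
    by (intro compact_imp_bounded compact_continuous_image continuous_on_subset[OF F_cont] compact_Times) auto
  then obtain B where "\<forall>p\<in>{0..T} \<times> cball 0 R. norm (case p of (t, u) \<Rightarrow> F t u) \<le> B"
    unfolding bounded_iff by blast
  then have "norm (F t x) \<le> B" if "t \<in> {0..T}" "norm x \<le> R" for t x
    using that by fastforce
  then show thesis by (rule that)
qed

lemma S_bounded:
  obtains B where "\<And>v g. primitive_on T a v g \<Longrightarrow> \<bar>S g\<bar> \<le> B"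
proof -
  have "bounded (\<Phi> ` cball 0 a)"
    by (intro compact_imp_bounded compact_continuous_image cont) simp
  then obtain B where B: "\<And>x. x \<in> cball 0 a \<Longrightarrow> norm (\<Phi> x) \<le> B"
    unfolding bounded_iff by blast
  have "\<bar>S g\<bar> \<le> T * B" if v: "primitive_on T a v g" for v g
    unfolding S_def using primitive_on_bound[OF v]
    by (intro norm_LINT_interval_le integrable_compose_primitive_on[OF v cont] B)
      (use T_pos in auto)
  then show thesis by (rule that)
qed

lemma energy_bounded_below_mean:
  obtains m where "\<And>v. v \<in> dom_PsiJ_mean T a j \<delta> \<Longrightarrow> ereal m \<le> energy T a \<Phi> F j v"
proof -
  obtain B where B: "\<And>t x. t \<in> {0..T} \<Longrightarrow> norm x \<le> \<delta> + a * T \<Longrightarrow> norm (F t x) \<le> B"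
    using F_bounded by blast
  obtain B' where B': "\<And>v g. primitive_on T a v g \<Longrightarrow> \<bar>S g\<bar> \<le> B'"
    using S_bounded by blast
  have "ereal (- B' - T * \<Phi> 0 - T * B) \<le> energy T a \<Phi> F j v" if v: "v \<in> dom_PsiJ_mean T a j \<delta>" for v
  proof -
    obtain g b where g: "primitive_on T a v g" "j (v 0, v T) = ereal b" "0 \<le> b"
      using dom_PsiJ_imp_primitive_on v unfolding dom_PsiJ_mean_def by blast
    have "norm (F t (v t)) \<le> B" if t: "t \<in> {0..T}" for t
      using norm_primitive_on_le_mean[OF g(1) t T_pos] v
      by (intro B[OF t]) (simp add: dom_PsiJ_mean_def)
    then have "\<bar>LINT t|lebesgue_on {0..T}. F t (v t)\<bar> \<le> T * B"
      by (intro norm_LINT_interval_le continuous_interval_measurable_bounded(3)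
          continuous_on_F_compose primitive_on_continuous[OF g(1)] less_imp_le[OF T_pos])
    then show ?thesis
      unfolding energy_primitive_on[OF g(1)] g(2) F_fun_def using B'[OF g(1)] g(3) by simp
  qed
  then show thesis by (rule that)
qed

text \<open>Keeps the infimum below infinity; with the lower bound it becomes a real number, so
  near-minimisers exist.\<close>

lemma zero_in_dom_PsiJ_mean:
  assumes "0 < \<delta>"
  shows "(\<lambda>_. 0) \<in> dom_PsiJ_mean T a j \<delta>" "energy T a \<Phi> F j (\<lambda>_. 0) < \<infinity>"
proof -
  have p: "primitive_on T a (\<lambda>_. 0) (\<lambda>_. 0)"
    using a_pos by (intro primitive_onI) auto
  have j: "j (0, 0) = 0" using j_0 by (simp add: zero_prod_def)
  show "(\<lambda>_. 0) \<in> dom_PsiJ_mean T a j \<delta>"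
    using primitive_on_imp_dom_PsiJ[OF p] assms j by (simp add: dom_PsiJ_mean_def mean_value_def)
  show "energy T a \<Phi> F j (\<lambda>_. 0) < \<infinity>"
    unfolding energy_primitive_on[OF p] j by simp
qed

text \<open>The direct method: the bound through the mean and the Lipschitz bound feed the
  Arzela-Ascoli theorem. \<open>F_fun\<close> and the mean pass to the limit, while the slope
  integral and \<open>j\<close> only obey inequalities.\<close>

lemma minimizer_mean_exists:
  assumes \<delta>: "0 < \<delta>"
  obtains u where "u \<in> dom_PsiJ_mean T a j \<delta>"
    "energy T a \<Phi> F j u = (INF v\<in>dom_PsiJ_mean T a j \<delta>. energy T a \<Phi> F j v)"
proof -
  let ?M = "lebesgue_on {0..T}"
  define E where "E = energy T a \<Phi> F j"
  define X where "X = dom_PsiJ_mean T a j \<delta>"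
  define R where "R = \<delta> + a * T"
  obtain m where m: "\<And>v. v \<in> X \<Longrightarrow> ereal m \<le> E v"
    unfolding E_def X_def using energy_bounded_below_mean by blast
  have "ereal m \<le> (INF v\<in>X. E v)"
    by (rule INF_greatest) (rule m)
  moreover have "(INF v\<in>X. E v) < \<infinity>"
    using zero_in_dom_PsiJ_mean[OF \<delta>] unfolding E_def X_def by (meson INF_lower le_less_trans)
  ultimately obtain l where l: "(INF v\<in>X. E v) = ereal l"
    by (cases "INF v\<in>X. E v") auto
  have "\<exists>v\<in>X. E v < ereal (l + 1 / real (Suc n))" for n
    using l by (subst INF_less_iff[symmetric]) simp
  then obtain v0 where v0: "\<And>n. v0 n \<in> X" "\<And>n. E (v0 n) < ereal (l + 1 / real (Suc n))"
    by metis
  have "\<exists>g b. primitive_on T a (v0 n) g \<and> j (v0 n 0, v0 n T) = ereal b \<and> 0 \<le> b" for n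
    using dom_PsiJ_imp_primitive_on[of "v0 n"] v0(1)[of n] unfolding X_def dom_PsiJ_mean_def by blast
  then obtain g0 b0 where g0: "\<And>n. primitive_on T a (v0 n) (g0 n)"
    "\<And>n. j (v0 n 0, v0 n T) = ereal (b0 n)"
    by metis
  have v0_mean: "norm (mean_value T (v0 n)) \<le> \<delta>" for n
    using v0(1)[of n] by (simp add: X_def dom_PsiJ_mean_def)
  have v0_bound: "norm (v0 n t) \<le> R" if "t \<in> {0..T}" for n t
    using norm_primitive_on_le_mean[OF g0(1) that T_pos, of n] v0_mean[of n] by (simp add: R_def)
  obtain u k where u: "continuous_on {0..T} u" "strict_mono (k :: nat \<Rightarrow> nat)"
      "\<And>e. 0 < e \<Longrightarrow> \<exists>N. \<forall>n t. n \<ge> N \<and> t \<in> {0..T} \<longrightarrow> norm (v0 (k n) t - u t) < e"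
  proof (rule Arzela_Ascoli[of "{0..T}" v0 R])
    fix t e :: real assume t: "t \<in> {0..T}" and e: "0 < e"
    have "norm (v0 n t - v0 n s) < e" if "s \<in> {0..T}" "norm (t - s) < e / a" for n s
    proof -
      have "norm (v0 n t - v0 n s) \<le> a * \<bar>t - s\<bar>"
        by (rule primitive_on_Lipschitz[OF g0(1) that(1) t])
      also have "\<dots> < e" using that(2) a_pos by (simp add: pos_less_divide_eq mult.commute)
      finally show ?thesis .
    qed
    then show "\<exists>d>0. \<forall>n s. s \<in> {0..T} \<and> norm (t - s) < d \<longrightarrow> norm (v0 n t - v0 n s) < e"
      using e a_pos by (intro exI[of _ "e / a"]) auto
  qed (use v0_bound in auto)
  obtain B where B: "\<And>v g. primitive_on T a v g \<Longrightarrow> \<bar>S g\<bar> \<le> B"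
    using S_bounded by blast
  \<comment> \<open>Uniform convergence does not make the integrals \<open>S\<close> converge; a
    further subsequence supplies the limit \<open>A\<close> that \<open>primitive_on_limit\<close>
    asks for.\<close>
  have "bounded (range (\<lambda>n. S (g0 (k n))))"
    using B[OF g0(1)] by (auto simp: bounded_iff)
  then obtain A r where r: "strict_mono (r :: nat \<Rightarrow> nat)" "((\<lambda>n. S (g0 (k n))) \<circ> r) \<longlonglongrightarrow> A"
    using bounded_imp_convergent_subsequence by blast
  define q where "q n = k (r n)" for n
  have q: "strict_mono q" using u(2) r(1) by (auto simp: q_def strict_mono_def)
  define v where "v n = v0 (q n)" for n
  define g where "g n = g0 (q n)" for n
  have g: "primitive_on T a (v n) (g n)" for n by (simp add: v_def g_def g0)
  have S_lim: "(\<lambda>n. S (g n)) \<longlonglongrightarrow> A" using r(2) by (simp add: comp_def g_def q_def)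
  have conv: "\<exists>N. \<forall>n\<ge>N. \<forall>t\<in>{0..T}. norm (v n t - u t) \<le> e" if "0 < e" for e
  proof -
    obtain N where N: "\<forall>n t. n \<ge> N \<and> t \<in> {0..T} \<longrightarrow> norm (v0 (k n) t - u t) < e"
      using u(3)[OF \<open>0 < e\<close>] by blast
    have "norm (v n t - u t) \<le> e" if "n \<ge> N" "t \<in> {0..T}" for n t
      using N seq_suble[OF r(1), of n] that by (simp add: v_def q_def less_imp_le)
    then show ?thesis by blast
  qed
  have v_lim: "(\<lambda>n. v n t) \<longlonglongrightarrow> u t" if "t \<in> {0..T}" for t
  proof (rule LIMSEQ_I)
    fix e :: real assume "0 < e"
    then obtain N where "\<forall>n\<ge>N. \<forall>t\<in>{0..T}. norm (v n t - u t) \<le> e / 2"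
      using conv[of "e / 2"] by auto
    then show "\<exists>N. \<forall>n\<ge>N. norm (v n t - u t) < e"
      using that \<open>0 < e\<close> by (intro exI[of _ N]) force
  qed
  have v_bound: "norm (v n t) \<le> R" if "t \<in> {0..T}" for n t
    using v0_bound[OF that] by (simp add: v_def)
  obtain h where h: "primitive_on T a u h" "S h \<le> A"
    using primitive_on_limit[OF T_pos g conv cont convex_Phi, of A] S_lim unfolding S_def by blast
  have const: "integrable ?M (\<lambda>_. c :: real)" for c
    by (rule finite_measure.integrable_const[OF finite_measure_lebesgue_on]) simp
  have F_lim: "(\<lambda>n. F_fun T F (v n)) \<longlonglongrightarrow> F_fun T F u"
  proof -
    obtain B where B: "\<And>t x. t \<in> {0..T} \<Longrightarrow> norm x \<le> R \<Longrightarrow> norm (F t x) \<le> B"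
      using F_bounded by blast
    have "(\<lambda>n. LINT t|?M. F t (v n t)) \<longlonglongrightarrow> (LINT t|?M. F t (u t))"
    proof (rule integral_dominated_convergence[OF _ _ const[of B]])
      show "(\<lambda>t. F t (u t)) \<in> borel_measurable ?M" "\<And>n. (\<lambda>t. F t (v n t)) \<in> borel_measurable ?M"
        by (intro continuous_interval_measurable_bounded(1) continuous_on_F_compose u(1)
            primitive_on_continuous[OF g])+
      show "AE t in ?M. (\<lambda>n. F t (v n t)) \<longlonglongrightarrow> F t (u t)"
      proof (rule AE_I2)
        fix t assume "t \<in> space ?M"
        then have t: "t \<in> {0..T}" by simp
        have "(\<lambda>n. (\<lambda>(t, u). F t u) (t, v n t)) \<longlonglongrightarrow> (\<lambda>(t, u). F t u) (t, u t)"
          by (rule continuous_on_tendsto_compose[OF F_cont])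
            (use t v_lim[OF t] in \<open>auto intro: tendsto_Pair\<close>)
        then show "(\<lambda>n. F t (v n t)) \<longlonglongrightarrow> F t (u t)" by simp
      qed
      show "AE t in ?M. norm (F t (v n t)) \<le> B" for n
        using v_bound by (intro AE_I2 B) auto
    qed
    then show ?thesis unfolding F_fun_def by (rule tendsto_minus)
  qed
  have "(\<lambda>n. mean_value T (v n)) \<longlonglongrightarrow> mean_value T u"
    unfolding mean_value_def
  proof (intro tendsto_scaleR tendsto_const integral_dominated_convergence[OF _ _ const[of R]])
    show "u \<in> borel_measurable ?M" "\<And>n. v n \<in> borel_measurable ?M"
      by (intro continuous_interval_measurable_bounded(1) u(1) primitive_on_continuous[OF g])+
    show "AE t in ?M. (\<lambda>n. v n t) \<longlonglongrightarrow> u t" "\<And>n. AE t in ?M. norm (v n t) \<le> R"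
      using v_lim v_bound by (intro AE_I2; simp)+
  qed
  then have u_mean: "norm (mean_value T u) \<le> \<delta>"
    using v0_mean by (intro LIMSEQ_le_const2[OF tendsto_norm]) (auto simp: v_def)
  \<comment> \<open>What the energy bound leaves for \<open>j (v n 0, v n T)\<close>. Its limit is
    known, so semicontinuity applies without convergence of the values of \<open>j\<close>.\<close>
  define b where "b n = l + 1 / real (Suc n) - (S (g n) - T * \<Phi> 0 + F_fun T F (v n))" for n
  have b_lim: "b \<longlonglongrightarrow> l + 0 - (A - T * \<Phi> 0 + F_fun T F u)"
    unfolding b_def by (intro tendsto_intros S_lim F_lim LIMSEQ_Suc[OF lim_1_over_n])
  have b_ge: "j (v n 0, v n T) \<le> ereal (b n)" for n
  proof -
    have "E (v n) < ereal (l + 1 / real (Suc (q n)))"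
      using v0(2)[of "q n"] by (simp add: v_def)
    also have "\<dots> \<le> ereal (l + 1 / real (Suc n))"
      using seq_suble[OF q, of n] by (simp add: field_simps)
    finally have "ereal (S (g n) - T * \<Phi> 0 + F_fun T F (v n)) + j (v n 0, v n T)
        < ereal (l + 1 / real (Suc n))"
      unfolding E_def energy_primitive_on[OF g] .
    moreover have "j (v n 0, v n T) = ereal (b0 (q n))"
      using g0(2)[of "q n"] by (simp add: v_def)
    ultimately show ?thesis by (simp add: b_def)
  qed
  have "(\<lambda>n. (v n 0, v n T)) \<longlonglongrightarrow> (u 0, u T)"
    by (intro tendsto_Pair v_lim) (use T_pos in auto)
  from lower_semicontinuous_sequentially[OF j_lsc this b_lim b_ge]
  have ju: "j (u 0, u T) \<le> ereal (l + 0 - (A - T * \<Phi> 0 + F_fun T F u))" .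
  then have "j (u 0, u T) < \<infinity>"
    by (rule le_less_trans) simp
  then have uX: "u \<in> X"
    using primitive_on_imp_dom_PsiJ[OF h(1)] u_mean
    by (auto simp: X_def dom_PsiJ_mean_def)
  have "E u \<le> ereal (S h - T * \<Phi> 0 + F_fun T F u) + ereal (l + 0 - (A - T * \<Phi> 0 + F_fun T F u))"
    unfolding E_def energy_primitive_on[OF h(1)] by (rule add_left_mono[OF ju])
  also have "\<dots> \<le> ereal l" using h(2) by simp
  finally have "E u \<le> (INF v\<in>X. E v)" by (simp add: l)
  then have "E u = (INF v\<in>X. E v)"
    using INF_lower[OF uX, of E] by (rule antisym)
  with uX show thesis unfolding E_def X_def by (rule that)
qed

section \<open>Reduction to the effective domain\<close>

lemma energy_outside_dom:
  assumes "v \<in> C_space T" "v \<notin> dom_PsiJ T a j"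
  shows "energy T a \<Phi> F j v = \<infinity>"
proof (cases "v \<in> K_set T a")
  case True
  then have "j (v 0, v T) = \<infinity>" using assms(2) by (auto simp: dom_PsiJ_def)
  then show ?thesis using True by (simp add: energy_def J_fun_def Psi_fun_def)
next
  case False
  then show ?thesis
    using j_nonneg[of "(v 0, v T)"] by (simp add: energy_def J_fun_def Psi_fun_def)
qed

lemma dom_PsiJ_subset_C_space: "dom_PsiJ T a j \<subseteq> C_space T"
  by (auto simp: dom_PsiJ_def K_set_def)

lemma INF_energy_C_space:
  "(INF v\<in>C_space T. energy T a \<Phi> F j v) = (INF v\<in>dom_PsiJ T a j. energy T a \<Phi> F j v)"
proof (rule antisym)
  show "(INF v\<in>C_space T. energy T a \<Phi> F j v) \<le> (INF v\<in>dom_PsiJ T a j. energy T a \<Phi> F j v)"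
    by (rule INF_superset_mono[OF dom_PsiJ_subset_C_space]) simp
  show "(INF v\<in>dom_PsiJ T a j. energy T a \<Phi> F j v) \<le> (INF v\<in>C_space T. energy T a \<Phi> F j v)"
  proof (rule INF_greatest)
    fix v :: "real \<Rightarrow> 'a" assume "v \<in> C_space T"
    then show "(INF v\<in>dom_PsiJ T a j. energy T a \<Phi> F j v) \<le> energy T a \<Phi> F j v"
      using energy_outside_dom[of v] by (cases "v \<in> dom_PsiJ T a j") (auto intro: INF_lower)
  qed
qed

end

section \<open>The Euler equation and the boundary condition\<close>

text \<open>The slope \<open>h\<close> is a parameter, so that the locale can be interpreted again
  with a continuous slope once one has been found.\<close>

locale bvp_minimizer = bvp +
  fixes u h :: "real \<Rightarrow> 'a" and ju :: real
  assumes u: "primitive_on T a u h" and ju: "j (u 0, u T) = ereal ju"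
    and minimal: "\<And>v. v \<in> dom_PsiJ T a j \<Longrightarrow> energy T a \<Phi> F j u \<le> energy T a \<Phi> F j v"
begin

definition f :: "real \<Rightarrow> 'a" where "f t = gradF t (u t)"

definition P :: "real \<Rightarrow> 'a" where "P t = integral {0..t} f"

lemma T_nonneg: "0 \<le> T" using T_pos by simp

lemma u_cont: "continuous_on {0..T} u"
  by (rule primitive_on_continuous[OF u])

lemma f_cont: "continuous_on {0..T} f"
  unfolding f_def by (rule continuous_on_gradF_compose[OF u_cont])

lemma P_cont: "continuous_on {0..T} P"
  unfolding P_def by (intro indefinite_integral_continuous_1 integrable_continuous_interval f_cont)

text \<open>Differentiation under the integral sign. The derivative at 0 is one-sided, which is all
  that segments inside \<open>K_set\<close> offer.\<close>

lemma F_variation_deriv: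
  assumes v: "continuous_on {0..T} v"
  shows "((\<lambda>s. F_fun T F (\<lambda>t. u t + s *\<^sub>R (v t - u t))) has_real_derivative
      - integral {0..T} (\<lambda>t. f t \<bullet> (v t - u t))) (at 0 within {0..1})"
proof -
  let ?w = "\<lambda>s t. u t + s *\<^sub>R (v t - u t)"
  have w: "continuous_on {0..T} (?w s)" for s
    by (intro continuous_intros u_cont v)
  have "((\<lambda>s. integral (cbox 0 T) (\<lambda>t. F t (?w s t))) has_real_derivative
      integral (cbox 0 T) (\<lambda>t. gradF t (?w 0 t) \<bullet> (v t - u t))) (at 0 within {0..1})"
  proof (rule leibniz_rule_field_derivative[where fx = "\<lambda>s t. gradF t (?w s t) \<bullet> (v t - u t)"])
    fix s t assume "t \<in> cbox 0 T"
    then have "(F t has_derivative (\<lambda>h. h \<bullet> gradF t (?w s t))) (at (?w s t))"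
      using F_grad[of t] by (simp add: gderiv_def)
    moreover have "((\<lambda>s. ?w s t) has_derivative (\<lambda>r. r *\<^sub>R (v t - u t))) (at s within {0..1})"
      by (auto intro!: derivative_eq_intros)
    ultimately have "((\<lambda>s. F t (?w s t)) has_derivative (\<lambda>r. (r *\<^sub>R (v t - u t)) \<bullet> gradF t (?w s t)))
        (at s within {0..1})"
      by (rule has_derivative_compose[rotated])
    then show "((\<lambda>s. F t (?w s t)) has_real_derivative gradF t (?w s t) \<bullet> (v t - u t)) (at s within {0..1})"
      by (simp add: has_field_derivative_def inner_commute mult.commute[of _ "_ \<bullet> _"])
  next
    fix s show "(\<lambda>t. F t (?w s t)) integrable_on cbox 0 T"
      unfolding cbox_interval by (intro integrable_continuous_interval continuous_on_F_compose w)
  next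
    have 1: "continuous_on ({0..1} \<times> cbox 0 T) (\<lambda>p. u (snd p))"
      "continuous_on ({0..1} \<times> cbox 0 T) (\<lambda>p. v (snd p))"
      by (auto intro!: continuous_on_compose2[OF u_cont] continuous_on_compose2[OF v] continuous_intros)
    have "continuous_on ({0..1} \<times> cbox 0 T) (\<lambda>p. (snd p, ?w (fst p) (snd p)))"
      by (intro continuous_intros 1)
    from continuous_on_compose2[OF gradF_cont this]
    have "continuous_on ({0..1} \<times> cbox 0 T) (\<lambda>p. gradF (snd p) (?w (fst p) (snd p)))"
      by (simp add: image_subset_iff mem_Times_iff)
    then show "continuous_on ({0..1} \<times> cbox 0 T) (\<lambda>(s, t). gradF t (?w s t) \<bullet> (v t - u t))"
      unfolding case_prod_beta by (intro continuous_intros 1)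
  qed auto
  then have "((\<lambda>s. - integral {0..T} (\<lambda>t. F t (?w s t))) has_real_derivative
      - integral {0..T} (\<lambda>t. f t \<bullet> (v t - u t))) (at 0 within {0..1})"
    by (intro DERIV_minus) (simp add: f_def)
  then show ?thesis by (simp add: F_fun_eq[OF w])
qed

lemma j_combination_le:
  assumes "j (x, y) \<le> ereal b" "0 < s" "s < 1"
  shows "j ((1 - s) *\<^sub>R u 0 + s *\<^sub>R x, (1 - s) *\<^sub>R u T + s *\<^sub>R y) \<le> ereal ((1 - s) * ju + s * b)"
proof -
  have "j ((1 - s) *\<^sub>R (u 0, u T) + s *\<^sub>R (x, y)) \<le> ereal (1 - s) * j (u 0, u T) + ereal s * j (x, y)"
    using j_convex assms(2,3) unfolding convex_fun_def by blast
  also have "\<dots> \<le> ereal (1 - s) * ereal ju + ereal s * ereal b"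
    unfolding ju using assms by (intro add_left_mono ereal_mult_left_mono) auto
  finally show ?thesis by simp
qed

text \<open>Along the segment to \<open>v\<close> the convex parts lie below their chord, so
  minimality bounds the difference quotient of \<open>F_fun\<close> from below by minus their
  increase; then \<open>s\<close> tends to 0. An upper bound \<open>b\<close> for \<open>j\<close>
  suffices, which spares computing it at competitors.\<close>

lemma linearized_minimality:
  assumes v: "primitive_on T a v g" and b: "j (v 0, v T) \<le> ereal b"
  shows "0 \<le> S g - S h + b - ju - integral {0..T} (\<lambda>t. f t \<bullet> (v t - u t))"
proof -
  let ?w = "\<lambda>s t. u t + s *\<^sub>R (v t - u t)"
  let ?Q = "\<lambda>s. F_fun T F (?w s)"
  have w_eq: "?w s t = (1 - s) *\<^sub>R u t + s *\<^sub>R v t" for s t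
    by (simp add: algebra_simps)
  have Q0: "?Q 0 = F_fun T F u" by simp
  have quot: "- (S g - S h + b - ju) \<le> (?Q s - ?Q 0) / (s - 0)" if s: "0 < s" "s < 1" for s
  proof -
    let ?g = "\<lambda>t. (1 - s) *\<^sub>R h t + s *\<^sub>R g t"
    have w: "primitive_on T a (?w s) ?g"
      unfolding w_eq using s by (intro primitive_on_convex_combination[OF u v]) auto
    have jw: "j (?w s 0, ?w s T) \<le> ereal ((1 - s) * ju + s * b)"
      unfolding w_eq using b s by (rule j_combination_le)
    then have "j (?w s 0, ?w s T) < \<infinity>" by (rule le_less_trans) simp
    then have "energy T a \<Phi> F j u \<le> energy T a \<Phi> F j (?w s)"
      by (rule minimal[OF primitive_on_imp_dom_PsiJ[OF w]])
    also have "\<dots> \<le> ereal (S ?g - T * \<Phi> 0 + ?Q s) + ereal ((1 - s) * ju + s * b)"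
      unfolding energy_primitive_on[OF w] by (rule add_left_mono[OF jw])
    finally have "S h + ?Q 0 + ju \<le> S ?g + ?Q s + ((1 - s) * ju + s * b)"
      unfolding energy_primitive_on[OF u] ju Q0 by simp
    moreover have "S ?g \<le> (1 - s) * S h + s * S g"
      unfolding S_def using s by (intro LINT_convex_combination_le[OF u v _ _ cont convex_Phi]) auto
    ultimately have "- (S g - S h + b - ju) * s \<le> ?Q s - ?Q 0"
      by (simp add: algebra_simps)
    then show ?thesis using s by (simp add: pos_le_divide_eq)
  qed
  have "((\<lambda>s. (?Q s - ?Q 0) / (s - 0)) \<longlongrightarrow> - integral {0..T} (\<lambda>t. f t \<bullet> (v t - u t))) (at_right 0)"
    using F_variation_deriv[OF primitive_on_continuous[OF v]]
    unfolding has_field_derivative_iff by (simp add: at_within_Icc_at_right)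
  moreover have "\<forall>\<^sub>F s::real in at_right 0. s < 1"
    by (rule order_tendstoD(2)[of _ 0]) (auto intro: tendsto_intros)
  then have "\<forall>\<^sub>F s in at_right 0. - (S g - S h + b - ju) \<le> (?Q s - ?Q 0) / (s - 0)"
    using eventually_at_right_less[of 0] by eventually_elim (rule quot)
  ultimately have "- (S g - S h + b - ju) \<le> - integral {0..T} (\<lambda>t. f t \<bullet> (v t - u t))"
    by (rule tendsto_lowerbound) simp
  then show ?thesis by simp
qed

lemma zero_primitive: "primitive_on T a (\<lambda>_. 0) (\<lambda>_. 0)"
  using a_pos by (intro primitive_onI) auto

text \<open>
  If the mean slope had norm \<open>a\<close>, then \<open>norm h = a\<close> almost everywhere, and since \<open>\<Phi>\<close> is infinitely
  steep at the boundary, shrinking \<open>u\<close> towards \<open>0\<close>, where \<open>j\<close> is finite, would lower the functional.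
\<close>

lemma norm_integral_h_less: "norm (integral {0..T} h) < a * T"
proof (rule ccontr)
  let ?M = "lebesgue_on {0..T}"
  assume "\<not> norm (integral {0..T} h) < a * T"
  then have ge: "a * T \<le> norm (integral {0..T} h)" by simp
  note hI = primitive_on_integrable[OF u]
  have const: "integrable ?M (\<lambda>_. c :: real)" for c
    by (rule finite_measure.integrable_const[OF finite_measure_lebesgue_on]) simp
  have int: "integrable ?M (\<lambda>t. a - norm (h t))" using const hI by simp
  have nonneg: "AE t in ?M. 0 \<le> a - norm (h t)"
    using primitive_on_bound[OF u] by (intro AE_I2) auto
  \<comment> \<open>The nonnegative function \<open>a - norm (h t)\<close> has integral at most 0,
    so it vanishes almost everywhere.\<close>
  have "(LINT t|?M. a - norm (h t)) = T * a - (LINT t|?M. norm (h t))"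
    using const[of a] hI T_nonneg by (simp add: LINT_const_interval del: lebesgue_integral_const)
  also have "norm (integral {0..T} h) \<le> (LINT t|?M. norm (h t))"
    unfolding LINT_interval_eq_integral[OF hI, symmetric] by (rule integral_norm_bound)
  then have "T * a - (LINT t|?M. norm (h t)) \<le> 0" using ge by (simp add: mult.commute)
  finally have "(LINT t|?M. a - norm (h t)) = 0"
    using integral_nonneg_AE[OF nonneg] by linarith
  then have "AE t in ?M. a - norm (h t) = 0"
    using integral_nonneg_eq_0_iff_AE[OF int nonneg] by simp
  then have ae: "AE t in ?M. norm (h t) = a"
    by eventually_elim simp
  \<comment> \<open>Chosen so that the gain \<open>T * (s * R)\<close> from steepness exceeds the
    linearised cost by exactly \<open>s\<close>.\<close>
  define R where "R = (integral {0..T} (\<lambda>t. f t \<bullet> u t) - ju + 1) / T"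
  obtain s where s: "0 < s" "s < 1" "\<And>x. norm x = a \<Longrightarrow> s * R \<le> \<Phi> x - \<Phi> ((1 - s) *\<^sub>R x)"
    using steep_at_boundary[of R] by blast
  let ?v = "\<lambda>t. (1 - s) *\<^sub>R u t + s *\<^sub>R 0" and ?g = "\<lambda>t. (1 - s) *\<^sub>R h t + s *\<^sub>R 0"
  have v: "primitive_on T a ?v ?g"
    using s by (intro primitive_on_convex_combination[OF u zero_primitive]) auto
  have "j (?v 0, ?v T) \<le> ereal ((1 - s) * ju + s * 0)"
    by (rule j_combination_le) (use s j_0 in \<open>auto simp: zero_prod_def\<close>)
  from linearized_minimality[OF v this]
  have "0 \<le> S ?g - S h - s * ju - integral {0..T} (\<lambda>t. f t \<bullet> ((1 - s) *\<^sub>R u t - u t))"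
    by (simp add: algebra_simps)
  also have "integral {0..T} (\<lambda>t. f t \<bullet> ((1 - s) *\<^sub>R u t - u t)) = - s * integral {0..T} (\<lambda>t. f t \<bullet> u t)"
    unfolding integral_mult_right[symmetric]
    by (rule Henstock_Kurzweil_Integration.integral_cong) (simp add: algebra_simps)
  finally have 1: "S h - S ?g \<le> s * (integral {0..T} (\<lambda>t. f t \<bullet> u t) - ju)"
    by (simp add: algebra_simps)
  note ih = integrable_compose_primitive_on[OF u cont] and ig = integrable_compose_primitive_on[OF v cont]
  have "T * (s * R) = (LINT t|?M. s * R)" using T_nonneg by (simp only: LINT_const_interval)
  also have "\<dots> \<le> (LINT t|?M. \<Phi> (h t) - \<Phi> (?g t))"
  proof (rule integral_mono_AE[OF const])
    show "integrable ?M (\<lambda>t. \<Phi> (h t) - \<Phi> (?g t))"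
      by (rule Bochner_Integration.integrable_diff[OF ih ig])
    show "AE t in ?M. s * R \<le> \<Phi> (h t) - \<Phi> (?g t)"
      using ae by eventually_elim (use s(3) in simp)
  qed
  also have "\<dots> = S h - S ?g"
    unfolding S_def by (rule Bochner_Integration.integral_diff[OF ih ig])
  finally have "T * (s * R) \<le> s * (integral {0..T} (\<lambda>t. f t \<bullet> u t) - ju)"
    using 1 by linarith
  moreover have "T * (s * R) = s * (integral {0..T} (\<lambda>t. f t \<bullet> u t) - ju) + s"
    using T_pos by (simp add: R_def field_simps)
  ultimately show False using s by simp
qed

text \<open>Integration by parts with \<open>integral {t..T} f = P T - P t\<close>. The boundary
  term disappears for a \<open>g\<close> of mean zero; for a constant \<open>g\<close> it supplies
  the part of the boundary condition at \<open>T\<close>.\<close>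

lemma integral_f_inner_primitive:
  assumes g: "g \<in> borel_measurable (lebesgue_on {0..T})" "\<And>t. t \<in> {0..T} \<Longrightarrow> norm (g t) \<le> B"
  shows "integral {0..T} (\<lambda>t. f t \<bullet> integral {0..t} g)
    = P T \<bullet> integral {0..T} g - (LINT t|lebesgue_on {0..T}. P t \<bullet> g t)"
proof -
  let ?M = "lebesgue_on {0..T}"
  note fm = continuous_interval_measurable_bounded[OF f_cont]
  note Pm = continuous_interval_measurable_bounded[OF P_cont]
  obtain A where A: "\<And>t. t \<in> {0..T} \<Longrightarrow> norm (f t) \<le> A"
    using fm(2) by blast
  obtain A' where A': "\<And>t. t \<in> {0..T} \<Longrightarrow> norm (P t) \<le> A'"
    using Pm(2) by blast
  have gI: "integrable ?M g" by (rule integrable_bounded_interval[OF g])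
  have gI': "g integrable_on {0..T}" by (rule integrable_on_lebesgue_on[OF gI]) simp
  have fI: "f integrable_on {0..T}" by (rule integrable_continuous_interval[OF f_cont])
  have PgI: "integrable ?M (\<lambda>t. P t \<bullet> g t)"
  proof (rule integrable_bounded_interval)
    show "(\<lambda>t. P t \<bullet> g t) \<in> borel_measurable ?M"
      using Pm(1) g(1) by measurable
    fix t assume t: "t \<in> {0..T}"
    have "norm (P t \<bullet> g t) \<le> norm (P t) * norm (g t)" by (simp add: Cauchy_Schwarz_ineq2)
    also have "\<dots> \<le> A' * B"
      using A'[OF t] g(2)[OF t] by (intro mult_mono) (auto intro: order_trans[OF norm_ge_zero])
    finally show "norm (P t \<bullet> g t) \<le> A' * B" .
  qed
  have "continuous_on {0..T} (\<lambda>t. f t \<bullet> integral {0..t} g)"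
    by (intro continuous_intros f_cont indefinite_integral_continuous_1 gI')
  then have "integral {0..T} (\<lambda>t. f t \<bullet> integral {0..t} g) = (LINT t|?M. f t \<bullet> integral {0..t} g)"
    by (intro LINT_interval_eq_integral[symmetric] continuous_interval_measurable_bounded(3))
  also have "\<dots> = (LINT t|?M. integral {t..T} f \<bullet> g t)"
    by (rule integral_by_parts_bilinear[OF bounded_bilinear_inner fm(1) A g])
  also have "\<dots> = (LINT t|?M. P T \<bullet> g t - P t \<bullet> g t)"
  proof (rule Bochner_Integration.integral_cong[OF refl])
    fix t assume "t \<in> space ?M"
    then have "P t + integral {t..T} f = P T"
      unfolding P_def using fI by (intro Henstock_Kurzweil_Integration.integral_combine) auto
    then have "integral {t..T} f = P T - P t"
      by (simp add: eq_diff_eq add.commute)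
    then show "integral {t..T} f \<bullet> g t = P T \<bullet> g t - P t \<bullet> g t"
      by (simp only: inner_diff_left)
  qed
  also have "\<dots> = (LINT t|?M. P T \<bullet> g t) - (LINT t|?M. P t \<bullet> g t)"
    using gI PgI by (intro Bochner_Integration.integral_diff) auto
  also have "(LINT t|?M. P T \<bullet> g t) = P T \<bullet> integral {0..T} g"
    using gI by (simp add: LINT_interval_eq_integral)
  finally show ?thesis .
qed

end

context bvp_minimizer
begin

text \<open>
  With \<open>c\<close> chosen so that \<open>\<psi> (c - P t)\<close> has the same integral as \<open>h\<close>, it is an admissible competitor,
  and strict convexity makes it the only minimiser.
\<close>

lemma slope_eq_psi:
  obtains c where "primitive_on T a u (\<lambda>t. \<psi> (c - P t))"
proof -
  let ?M = "lebesgue_on {0..T}"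
  obtain c where c: "integral {0..T} (\<lambda>t. \<psi> (c - P t)) = integral {0..T} h"
    using ex_integral_psi_eq[OF T_pos P_cont norm_integral_h_less] by blast
  define d where "d t = \<psi> (c - P t)" for t
  have d_cont: "continuous_on {0..T} d"
    unfolding d_def by (intro continuous_on_compose2[OF psi_cont] continuous_intros P_cont) auto
  note d_meas = continuous_interval_measurable_bounded(1)[OF d_cont]
  have d_bound: "norm (d t) < a" for t by (simp add: d_def psi_ball)
  \<comment> \<open>Equal integrals of the slopes give \<open>v\<close> the end values of
    \<open>u\<close>, so the contributions of \<open>j\<close> cancel.\<close>
  define v where "v t = u 0 + integral {0..t} d" for t
  have v: "primitive_on T a v d"
    by (rule primitive_onI[OF d_meas]) (simp_all add: v_def d_bound less_imp_le)
  have T_in: "T \<in> {0..T}" using T_pos by simp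
  have "v 0 = u 0" "v T = u T"
    using c primitive_on_eq[OF u T_in] by (simp_all add: v_def d_def[abs_def])
  then have "j (v 0, v T) \<le> ereal ju" using ju by simp
  note lin = linearized_minimality[OF v this]
  have sub: "d integrable_on {0..t}" "h integrable_on {0..t}" if "t \<in> {0..T}" for t
    using integrable_on_subinterval[OF primitive_on_integrable_on[OF v], of 0 t]
      integrable_on_subinterval[OF primitive_on_integrable_on[OF u], of 0 t] that by auto
  have dh_meas: "(\<lambda>t. d t - h t) \<in> borel_measurable ?M"
    using d_meas primitive_on_measurable[OF u] by measurable
  have dh_bound: "norm (d t - h t) \<le> a + a" if "t \<in> {0..T}" for t
    by (rule order_trans[OF norm_triangle_ineq4 add_mono])
      (use d_bound[of t] primitive_on_bound[OF u that] in auto)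
  have "integral {0..T} (\<lambda>t. f t \<bullet> (v t - u t)) = integral {0..T} (\<lambda>t. f t \<bullet> integral {0..t} (\<lambda>t. d t - h t))"
  proof (rule Henstock_Kurzweil_Integration.integral_cong)
    fix t assume t: "t \<in> {0..T}"
    show "f t \<bullet> (v t - u t) = f t \<bullet> integral {0..t} (\<lambda>t. d t - h t)"
      unfolding Henstock_Kurzweil_Integration.integral_diff[OF sub[OF t]] primitive_on_eq[OF u t] v_def by simp
  qed
  also have "\<dots> = P T \<bullet> integral {0..T} (\<lambda>t. d t - h t) - (LINT t|?M. P t \<bullet> (d t - h t))"
    by (rule integral_f_inner_primitive[OF dh_meas dh_bound])
  also have "integral {0..T} (\<lambda>t. d t - h t) = 0"
    using c Henstock_Kurzweil_Integration.integral_diff[OF sub[OF T_in]] by (simp add: d_def[abs_def])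
  finally have le: "S h - S d \<le> (LINT t|?M. P t \<bullet> (d t - h t))"
    using lin by simp
  \<comment> \<open>The gap in the gradient inequality at \<open>d t\<close>, where
    \<open>\<phi> (d t) = c - P t\<close>. It is nonnegative and vanishes only if the slopes agree,
    while linearised minimality makes its integral nonpositive.\<close>
  define G where "G t = \<Phi> (h t) - \<Phi> (d t) - (c - P t) \<bullet> (h t - d t)" for t
  have G_pos: "0 \<le> G t" "G t = 0 \<Longrightarrow> h t = d t" if "t \<in> {0..T}" for t
    using gradient_inequality[OF d_bound primitive_on_bound[OF u that], of t]
      gradient_inequality_strict[OF d_bound primitive_on_bound[OF u that], of t]
    by (auto simp: G_def d_def phi_psi)
  note hI = primitive_on_integrable[OF u] and dI = primitive_on_integrable[OF v]
  obtain A where A: "\<And>t. t \<in> {0..T} \<Longrightarrow> norm (P t) \<le> A"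
    using continuous_interval_measurable_bounded(2)[OF P_cont] by blast
  have PI: "integrable ?M (\<lambda>t. P t \<bullet> (d t - h t))"
  proof (rule integrable_bounded_interval)
    show "(\<lambda>t. P t \<bullet> (d t - h t)) \<in> borel_measurable ?M"
      using continuous_interval_measurable_bounded(1)[OF P_cont] dh_meas by (rule borel_measurable_inner)
    fix t assume t: "t \<in> {0..T}"
    have "norm (P t \<bullet> (d t - h t)) \<le> norm (P t) * norm (d t - h t)"
      by (simp add: Cauchy_Schwarz_ineq2)
    also have "\<dots> \<le> A * (a + a)"
      using A[OF t] dh_bound[OF t] by (intro mult_mono) (auto intro: order_trans[OF norm_ge_zero])
    finally show "norm (P t \<bullet> (d t - h t)) \<le> A * (a + a)" .
  qed
  have cI: "integrable ?M (\<lambda>t. c \<bullet> (d t - h t))" using hI dI by auto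
  have G_eq: "G t = \<Phi> (h t) - \<Phi> (d t) + (c \<bullet> (d t - h t) - P t \<bullet> (d t - h t))" for t
    by (simp add: G_def inner_diff_left inner_diff_right)
  note \<Phi>I = integrable_compose_primitive_on[OF u cont] integrable_compose_primitive_on[OF v cont]
  have GI: "integrable ?M G"
    unfolding G_eq[abs_def] using cI PI \<Phi>I by simp
  \<comment> \<open>Equal means remove the constant \<open>c\<close> from the integral of
    \<open>G\<close>.\<close>
  have "(LINT t|?M. d t - h t) = 0"
    using hI dI c by (simp add: LINT_interval_eq_integral d_def[abs_def])
  then have "(LINT t|?M. c \<bullet> (d t - h t)) = 0"
    using Bochner_Integration.integrable_diff[OF dI hI] by (subst integral_inner_right) auto
  then have "(LINT t|?M. G t) = S h - S d - (LINT t|?M. P t \<bullet> (d t - h t))"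
    unfolding G_eq S_def using cI PI \<Phi>I by simp
  moreover have nonneg: "AE t in ?M. 0 \<le> G t" using G_pos(1) by (intro AE_I2) simp
  ultimately have "(LINT t|?M. G t) = 0"
    using le integral_nonneg_AE[OF nonneg] by linarith
  then have "AE t in ?M. G t = 0"
    using integral_nonneg_eq_0_iff_AE[OF GI nonneg] by simp
  then have ae: "AE t in ?M. h t = d t"
    using AE_space by eventually_elim (use G_pos(2) in auto)
  have "primitive_on T a u d"
  proof (rule primitive_onI[OF d_meas])
    fix t assume t: "t \<in> {0..T}"
    show "norm (d t) \<le> a" using d_bound by (rule less_imp_le)
    have "integral {0..t} h = integral {0..t} d"
      unfolding integral_upto_eq_LINT[OF hI t, symmetric] integral_upto_eq_LINT[OF dI t, symmetric]
    proof (rule integral_cong_AE)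
      show "AE s in ?M. indicator {..t} s *\<^sub>R h s = indicator {..t} s *\<^sub>R d s"
        using ae by eventually_elim simp
    qed (use integrable_indicator_lebesgue_on[OF hI, of "{..t}"]
          integrable_indicator_lebesgue_on[OF dI, of "{..t}"] in auto)
    then show "u t = u 0 + integral {0..t} d"
      using primitive_on_eq[OF u t] by simp
  qed
  then show thesis unfolding d_def by (rule that)
qed

text \<open>The variation is by the affine function that moves the end values of \<open>u\<close>
  towards \<open>(x, y)\<close>. The continuous slope has a maximal norm below \<open>a\<close>, so
  the variation is admissible for small \<open>s\<close>.\<close>

lemma boundary_inclusion:
  assumes d: "primitive_on T a u (\<lambda>t. \<psi> (c - P t))"
  shows "(c, P T - c) \<in> subdifferential j (u 0, u T)"
proof -
  let ?M = "lebesgue_on {0..T}"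
  define d where "d t = \<psi> (c - P t)" for t
  have ud: "primitive_on T a u d" using d by (simp add: d_def[abs_def])
  \<comment> \<open>Linearised minimality is used from here on with the continuous slope
    \<open>d\<close> in place of \<open>h\<close>.\<close>
  interpret D: bvp_minimizer a \<phi> \<psi> \<Phi> T F gradF j u d ju
    using ud ju minimal by unfold_locales
  have d_cont: "continuous_on {0..T} d"
    unfolding d_def by (intro continuous_on_compose2[OF psi_cont] continuous_intros P_cont) auto
  have "compact (norm ` d ` {0..T})" "norm ` d ` {0..T} \<noteq> {}"
    using T_pos by (auto intro!: compact_continuous_image continuous_on_norm_id d_cont)
  from compact_attains_sup[OF this]
  obtain r where r: "r \<in> norm ` d ` {0..T}" "\<And>t. t \<in> {0..T} \<Longrightarrow> norm (d t) \<le> r"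
    by blast
  have ra: "r < a" using r(1) psi_ball by (auto simp: d_def)
  have "j (u 0, u T) + ereal ((c, P T - c) \<bullet> ((x, y) - (u 0, u T))) \<le> j (x, y)" for x y
  proof (cases "j (x, y)")
    case (real b)
    define p where "p = x - u 0"
    define q where "q = y - u T"
    define k where "k = (1 / T) *\<^sub>R (q - p)"
    have Tk: "T *\<^sub>R k = q - p" using T_pos by (simp add: k_def)
    define z where "z t = p + t *\<^sub>R k" for t
    have z_ends: "z 0 = p" "z T = q" by (simp_all add: z_def Tk)
    \<comment> \<open>Keeps the displaced slope within \<open>r + (a - r) / 2 < a\<close>; adding 1
      covers the case \<open>k = 0\<close>.\<close>
    define s0 where "s0 = (a - r) / (2 * (norm k + 1))"
    have s0: "0 < s0" using ra by (simp add: s0_def add_nonneg_pos)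
    have inside: "norm (d t + s *\<^sub>R k) < a" if t: "t \<in> {0..T}" and s: "0 \<le> s" "s \<le> s0" for s t
    proof -
      have "s * norm k \<le> s0 * (norm k + 1)" using s by (intro mult_mono) auto
      also have "\<dots> = (a - r) / 2"
        by (simp add: s0_def field_simps add_nonneg_eq_0_iff)
      finally have "norm (s *\<^sub>R k) \<le> (a - r) / 2" using s by simp
      then have "norm (d t + s *\<^sub>R k) \<le> r + (a - r) / 2"
        by (intro order_trans[OF norm_triangle_ineq add_mono] r(2)[OF t])
      also have "\<dots> < a" using ra by (simp add: field_simps)
      finally show ?thesis .
    qed
    \<comment> \<open>Bounds the difference quotient of \<open>S\<close> from above, by the gradient
      inequality taken at the displaced slope. Continuity of \<open>\<phi>\<close> gives the limit
      \<open>W 0\<close>, so \<open>S\<close> need not be differentiated.\<close>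
    define W where "W s = integral {0..T} (\<lambda>t. \<phi> (d t + s *\<^sub>R k) \<bullet> k)" for s
    have phi_cont: "continuous_on (ball 0 a) \<phi>" using homeo by (simp add: homeomorphism_def)
    have d_snd: "continuous_on ({0..s0} \<times> cbox 0 T) (\<lambda>p. d (snd p))"
      by (auto intro!: continuous_on_compose2[OF d_cont] continuous_intros)
    have "continuous_on ({0..s0} \<times> cbox 0 T) (\<lambda>p. d (snd p) + fst p *\<^sub>R k)"
      by (intro continuous_intros d_snd)
    then have "continuous_on ({0..s0} \<times> cbox 0 T) (\<lambda>p. \<phi> (d (snd p) + fst p *\<^sub>R k))"
      by (rule continuous_on_compose2[OF phi_cont]) (use inside in auto)
    then have joint: "continuous_on ({0..s0} \<times> cbox 0 T) (\<lambda>(s, t). \<phi> (d t + s *\<^sub>R k) \<bullet> k)"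
      unfolding case_prod_beta by (intro continuous_intros)
    have "continuous_on {0..s0} W"
      unfolding W_def using integral_continuous_on_param[OF joint] by simp
    then have W_lim: "(W \<longlongrightarrow> W 0) (at_right 0)"
      using s0 by (simp add: continuous_on_def at_within_Icc_at_right[symmetric])
    \<comment> \<open>The integral of \<open>P t \<bullet> k\<close> is left unevaluated: the same
      term occurs in \<open>W 0\<close> and cancels.\<close>
    have f_z: "integral {0..T} (\<lambda>t. f t \<bullet> z t)
        = P T \<bullet> q - integral {0..T} (\<lambda>t. P t \<bullet> k)"
    proof -
      have fI: "f integrable_on {0..T}" by (rule integrable_continuous_interval[OF f_cont])
      have "integral {0..T} (\<lambda>t. f t \<bullet> z t)
          = integral {0..T} (\<lambda>t. f t \<bullet> p + f t \<bullet> integral {0..t} (\<lambda>_. k))"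
        by (rule Henstock_Kurzweil_Integration.integral_cong) (simp add: z_def inner_add_right)
      also have "\<dots> = integral {0..T} (\<lambda>t. f t \<bullet> p)
          + integral {0..T} (\<lambda>t. f t \<bullet> integral {0..t} (\<lambda>_. k))"
        by (intro Henstock_Kurzweil_Integration.integral_add integrable_continuous_interval
            continuous_intros f_cont indefinite_integral_continuous_1)
      also have "integral {0..T} (\<lambda>t. f t \<bullet> p) = P T \<bullet> p"
        unfolding P_def by (rule integral_inner_left(1)[OF fI])
      also have "integral {0..T} (\<lambda>t. f t \<bullet> integral {0..t} (\<lambda>_. k))
          = P T \<bullet> integral {0..T} (\<lambda>_. k) - (LINT t|?M. P t \<bullet> k)"
        by (rule integral_f_inner_primitive[where B = "norm k"]) auto
      also have "(LINT t|?M. P t \<bullet> k) = integral {0..T} (\<lambda>t. P t \<bullet> k)"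
        by (intro LINT_interval_eq_integral continuous_interval_measurable_bounded(3) continuous_intros P_cont)
      finally show ?thesis
        using T_nonneg Tk by (simp add: inner_diff_right)
    qed
    have main: "0 \<le> W s + (b - ju) - integral {0..T} (\<lambda>t. f t \<bullet> z t)" if s: "0 < s" "s < 1" "s \<le> s0" for s
    proof -
      let ?v = "\<lambda>t. u t + s *\<^sub>R z t" and ?g = "\<lambda>t. d t + s *\<^sub>R k"
      have g_cont: "continuous_on {0..T} ?g" by (intro continuous_intros d_cont)
      have g: "norm (?g t) < a" if "t \<in> {0..T}" for t using inside[OF that] s by simp
      have v: "primitive_on T a ?v ?g"
      proof (rule primitive_onI)
        show "?g \<in> borel_measurable ?M" by (rule continuous_interval_measurable_bounded(1)[OF g_cont])
        fix t assume t: "t \<in> {0..T}"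
        show "norm (?g t) \<le> a" using g[OF t] by simp
        have "d integrable_on {0..t}"
          using integrable_on_subinterval[OF primitive_on_integrable_on[OF ud], of 0 t] t by auto
        then have "integral {0..t} ?g = integral {0..t} d + t *\<^sub>R (s *\<^sub>R k)"
          using t Henstock_Kurzweil_Integration.integral_add[OF _ integrable_const_ivl, of d 0 t "s *\<^sub>R k"]
          by simp
        then show "?v t = ?v 0 + integral {0..t} ?g"
          unfolding primitive_on_eq[OF ud t] by (simp add: z_def algebra_simps)
      qed
      have "?v 0 = (1 - s) *\<^sub>R u 0 + s *\<^sub>R x" "?v T = (1 - s) *\<^sub>R u T + s *\<^sub>R y"
        unfolding z_ends p_def q_def by (simp_all add: algebra_simps)
      then have "j (?v 0, ?v T) \<le> ereal ((1 - s) * ju + s * b)"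
        using j_combination_le[of x y b s] real s by simp
      from D.linearized_minimality[OF v this]
      have 1: "0 \<le> S ?g - S d + ((1 - s) * ju + s * b) - ju - integral {0..T} (\<lambda>t. f t \<bullet> (s *\<^sub>R z t))"
        by simp
      have 2: "integral {0..T} (\<lambda>t. f t \<bullet> (s *\<^sub>R z t)) = s * integral {0..T} (\<lambda>t. f t \<bullet> z t)"
        by simp
      have \<phi>_cont: "continuous_on {0..T} (\<lambda>t. \<phi> (?g t) \<bullet> k)"
        by (intro continuous_intros continuous_on_compose2[OF phi_cont g_cont]) (use g in auto)
      note \<phi>I = continuous_interval_measurable_bounded(3)[OF \<phi>_cont]
      note gI = integrable_compose_primitive_on[OF v cont] and dI = integrable_compose_primitive_on[OF ud cont]
      have "S ?g - S d = (LINT t|?M. \<Phi> (?g t) - \<Phi> (d t))"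
        unfolding S_def by (rule Bochner_Integration.integral_diff[OF gI dI, symmetric])
      also have "\<dots> \<le> (LINT t|?M. s * (\<phi> (?g t) \<bullet> k))"
      proof (rule integral_mono)
        fix t assume "t \<in> space ?M"
        then have t: "t \<in> {0..T}" by simp
        show "\<Phi> (?g t) - \<Phi> (d t) \<le> s * (\<phi> (?g t) \<bullet> k)"
          using gradient_inequality[OF g[OF t] primitive_on_bound[OF ud t]] by simp
      qed (use gI dI \<phi>I in auto)
      also have "\<dots> = s * W s"
        using LINT_interval_eq_integral[OF \<phi>I] by (simp add: W_def)
      finally have "0 \<le> s * (W s + (b - ju) - integral {0..T} (\<lambda>t. f t \<bullet> z t))"
        using 1 unfolding 2 by (simp add: algebra_simps)
      then show ?thesis using s(1) by (simp add: zero_le_mult_iff)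
    qed
    have "\<forall>\<^sub>F s::real in at_right 0. s < min 1 s0"
      by (rule order_tendstoD(2)[of _ 0]) (use s0 in \<open>auto intro: tendsto_intros\<close>)
    then have ev: "\<forall>\<^sub>F s in at_right 0. 0 \<le> W s + (b - ju) - integral {0..T} (\<lambda>t. f t \<bullet> z t)"
      using eventually_at_right_less[of 0] by eventually_elim (rule main, auto)
    have "((\<lambda>s. W s + (b - ju) - integral {0..T} (\<lambda>t. f t \<bullet> z t))
        \<longlongrightarrow> W 0 + (b - ju) - integral {0..T} (\<lambda>t. f t \<bullet> z t)) (at_right 0)"
      by (intro tendsto_intros W_lim)
    then have "0 \<le> W 0 + (b - ju) - integral {0..T} (\<lambda>t. f t \<bullet> z t)"
      by (rule tendsto_lowerbound[OF _ ev]) simp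
    moreover have "W 0 = c \<bullet> (q - p) - integral {0..T} (\<lambda>t. P t \<bullet> k)"
    proof -
      have "W 0 = integral {0..T} (\<lambda>t. c \<bullet> k - P t \<bullet> k)"
        by (simp add: W_def d_def phi_psi inner_diff_left)
      also have "\<dots> = integral {0..T} (\<lambda>t. c \<bullet> k) - integral {0..T} (\<lambda>t. P t \<bullet> k)"
        by (intro Henstock_Kurzweil_Integration.integral_diff integrable_continuous_interval
            continuous_intros P_cont)
      also have "integral {0..T} (\<lambda>t. c \<bullet> k) = c \<bullet> (T *\<^sub>R k)"
        using T_nonneg by simp
      finally show ?thesis unfolding Tk .
    qed
    ultimately have "ju + (c \<bullet> p + (P T - c) \<bullet> q) \<le> b"
      unfolding f_z by (simp add: inner_diff_left inner_diff_right)
    then show ?thesis using real ju by (simp add: p_def q_def)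
  \<comment> \<open>The value \<open>\<infinity>\<close> on the right is trivial, and
    \<open>-\<infinity>\<close> is excluded by nonnegativity.\<close>
  qed (use j_nonneg[of "(x, y)"] in auto)
  then show ?thesis unfolding subdifferential_def by auto
qed

text \<open>Continuity of \<open>\<psi> (c - P t)\<close> gives the regularity of \<open>u\<close>,
  and applying \<open>\<phi>\<close> to it leaves \<open>c - P t\<close>, with derivative
  \<open>- f t\<close>. Since \<open>P 0 = 0\<close>, the pair \<open>(c, P T - c)\<close> is the
  required boundary value.\<close>

lemma minimizer_is_solution: "is_solution T a \<phi> gradF j u"
proof -
  obtain c where d: "primitive_on T a u (\<lambda>t. \<psi> (c - P t))"
    by (rule slope_eq_psi)
  let ?d = "\<lambda>t. \<psi> (c - P t)"
  have d_cont: "continuous_on {0..T} ?d"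
    by (intro continuous_on_compose2[OF psi_cont] continuous_intros P_cont) auto
  have du: "C1_with_deriv T u ?d"
    unfolding C1_with_deriv_def
  proof (intro conjI ballI d_cont)
    fix t assume t: "t \<in> {0..T}"
    have "((\<lambda>t. u 0 + integral {0..t} ?d) has_vector_derivative 0 + ?d t) (at t within {0..T})"
      by (intro has_vector_derivative_add has_vector_derivative_const
          integral_has_vector_derivative[OF d_cont t])
    then have "((\<lambda>t. u 0 + integral {0..t} ?d) has_vector_derivative ?d t) (at t within {0..T})"
      by simp
    then show "(u has_vector_derivative ?d t) (at t within {0..T})"
      by (rule has_vector_derivative_transform[OF t, rotated]) (rule primitive_on_eq[OF d])
  qed
  have dw: "C1_with_deriv T (\<lambda>t. \<phi> (?d t)) (\<lambda>t. - f t)"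
    unfolding C1_with_deriv_def phi_psi
  proof (intro conjI ballI continuous_intros f_cont)
    fix t assume t: "t \<in> {0..T}"
    have "((\<lambda>t. c - integral {0..t} f) has_vector_derivative 0 - f t) (at t within {0..T})"
      by (intro has_vector_derivative_diff has_vector_derivative_const
          integral_has_vector_derivative[OF f_cont t])
    then show "((\<lambda>t. c - P t) has_vector_derivative - f t) (at t within {0..T})"
      by (simp add: P_def[abs_def])
  qed
  have "P 0 = 0" by (simp add: P_def)
  then have "(\<phi> (?d 0), - \<phi> (?d T)) \<in> subdifferential j (u 0, u T)"
    using boundary_inclusion[OF d] by (simp add: phi_psi)
  then show ?thesis
    unfolding is_solution_def using du dw psi_ball
    by (intro exI[of _ ?d] exI[of _ "\<lambda>t. - f t"]) (auto simp: f_def)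
qed

end

theorem theorem4p4:
  fixes T a \<delta> :: real
    and \<phi> :: "real ^ 'n \<Rightarrow> real ^ 'n"
    and \<Phi> :: "real ^ 'n \<Rightarrow> real"
    and F :: "real \<Rightarrow> real ^ 'n \<Rightarrow> real"
    and gradF :: "real \<Rightarrow> real ^ 'n \<Rightarrow> real ^ 'n"
    and j :: "(real ^ 'n) \<times> (real ^ 'n) \<Rightarrow> ereal"
  assumes T_pos: "0 < T" and a_pos: "0 < a"
    and phi_homeo: "\<exists>\<psi>. homeomorphism (ball 0 a) UNIV \<phi> \<psi>"
    and phi_0: "\<phi> 0 = 0"
    and Phi_grad: "\<And>x. x \<in> ball 0 a \<Longrightarrow> GDERIV \<Phi> x :> \<phi> x"
    and Phi_nonpos: "\<And>x. x \<in> cball 0 a \<Longrightarrow> \<Phi> x \<le> 0"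
    and Phi_C1: "continuous_on (ball 0 a) \<phi>"
    and Phi_cont: "continuous_on (cball 0 a) \<Phi>"
    and Phi_convex: "strictly_convex_on (cball 0 a) \<Phi>"
    and F_cont: "continuous_on ({0..T} \<times> UNIV) (\<lambda>(t, u). F t u)"
    and F_grad: "\<And>t u. t \<in> {0..T} \<Longrightarrow> GDERIV (F t) u :> gradF t u"
    and gradF_cont: "continuous_on ({0..T} \<times> UNIV) (\<lambda>(t, u). gradF t u)"
    and F_0: "\<And>t. t \<in> {0..T} \<Longrightarrow> F t 0 = 0"
    and j_proper: "proper_fun j"
    and j_convex: "convex_fun j"
    and j_lsc: "lower_semicontinuous j"
    and j_0: "j 0 = 0"
    and j_subdiff: "0 \<in> subdifferential j 0"
    and delta_pos: "0 < \<delta>"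
    and inf_eq: "(INF v\<in>dom_PsiJ_mean T a j \<delta>. energy T a \<Phi> F j v)
               = (INF v\<in>dom_PsiJ T a j. energy T a \<Phi> F j v)"
  shows "(\<exists>m::real. \<forall>v\<in>C_space T. ereal m \<le> energy T a \<Phi> F j v) \<and>
         (\<exists>u\<in>dom_PsiJ_mean T a j \<delta>.
            energy T a \<Phi> F j u = (INF v\<in>C_space T. energy T a \<Phi> F j v) \<and>
            is_solution T a \<phi> gradF j u)"
proof -
  obtain \<psi> where \<psi>: "homeomorphism (ball 0 a) UNIV \<phi> \<psi>" using phi_homeo by blast
  have j_nonneg: "0 \<le> j z" for z
  proof -
    have "j 0 + ereal (0 \<bullet> (z - 0)) \<le> j z"
      using j_subdiff unfolding subdifferential_def by blast
    then show ?thesis by (simp add: j_0)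
  qed
  interpret bvp a \<phi> \<psi> \<Phi> T F gradF j
    by unfold_locales (fact a_pos \<psi> Phi_grad Phi_nonpos Phi_cont Phi_convex T_pos F_cont F_grad
        gradF_cont j_convex j_lsc j_nonneg j_0)+
  obtain u where umin: "u \<in> dom_PsiJ_mean T a j \<delta>"
    "energy T a \<Phi> F j u = (INF v\<in>dom_PsiJ_mean T a j \<delta>. energy T a \<Phi> F j v)"
    by (rule minimizer_mean_exists[OF delta_pos])
  \<comment> \<open>The hypothesis on the infima lifts the bound on the mean; the infinite energy
    off the effective domain extends the infimum to all of \<open>C_space T\<close>.\<close>
  have uC: "energy T a \<Phi> F j u = (INF v\<in>C_space T. energy T a \<Phi> F j v)"
    using umin(2) inf_eq INF_energy_C_space by simp
  then have min: "energy T a \<Phi> F j u \<le> energy T a \<Phi> F j v" if "v \<in> C_space T" for v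
    using that by (simp add: INF_lower)
  obtain m where m: "\<And>v. v \<in> dom_PsiJ_mean T a j \<delta> \<Longrightarrow> ereal m \<le> energy T a \<Phi> F j v"
    using energy_bounded_below_mean by blast
  \<comment> \<open>\<open>m\<close> is a bound under the constraint on the mean; \<open>u\<close>
    satisfies that constraint and minimises over all of \<open>C_space T\<close>, so
    \<open>m\<close> is a bound everywhere.\<close>
  have bounded_below: "\<forall>v\<in>C_space T. ereal m \<le> energy T a \<Phi> F j v"
    using order_trans[OF m[OF umin(1)] min] by blast
  have "u \<in> dom_PsiJ T a j" using umin(1) by (simp add: dom_PsiJ_mean_def)
  then obtain h b where h: "primitive_on T a u h" "j (u 0, u T) = ereal b"
    using dom_PsiJ_imp_primitive_on by blast
  interpret bvp_minimizer a \<phi> \<psi> \<Phi> T F gradF j u h b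
    using h min dom_PsiJ_subset_C_space by unfold_locales auto
  have "is_solution T a \<phi> gradF j u" by (rule minimizer_is_solution)
  then show ?thesis using bounded_below umin(1) uC by blast
qed

end
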